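(* Let $0<r_1<r_2$, $A(r_1,r_2)=\{x\in\mathbb{R}^n:r_1<|x|<r_2\}$, let $p(x)=p(|x|)$ be radial and measurable with $1<p^-\le p(r)\le p^+<\infty$, and let $\Gamma$ be the family of locally rectifiable curves joining $S^{n-1}_{r_1}$ and $S^{n-1}_{r_2}$ inside $A(r_1,r_2)$. Then the unique extremal density for $\mathrm{M}_{p(\cdot)}(\Gamma)$ is radial and given by $$\rho_*(r)=\left(\frac{\lambda}{p(r)\,\omega_{n-1}\,r^{n-1}}\right)^{\frac{1}{p(r)-1}},$$ where $\lambda>0$ is the unique constant with $\int_{r_1}^{r_2}\rho_*(r)\,dr=1$. Moreover, $$\mathrm{M}_{p(\cdot)}(\Gamma)=\omega_{n-1}\int_{r_1}^{r_2}\left(\frac{\lambda}{p(r)\,\omega_{n-1}\,r^{n-1}}\right)^{\frac{p(r)}{p(r)-1}}r^{n-1}\,dr.$$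
   Context: $S^{n-1}_r=\{x\in\mathbb{R}^n:|x|=r\}$; $\omega_{n-1}$ is the surface measure of the unit sphere in $\mathbb{R}^n$. A density $\rho\colon\mathbb{R}^n\to[0,\infty]$ is admissible for $\Gamma$ if Borel and $\int_\gamma\rho\,ds\ge1$ for all locally rectifiable $\gamma\in\Gamma$. $\mathrm{M}_{p(\cdot)}(\Gamma)=\inf_\rho\int_{A(r_1,r_2)}\rho(x)^{p(x)}dx$ over admissible $\rho$; an extremal density is an admissible density attaining this infimum. *)

theory Defs
  imports "HOL-Analysis.Analysis"
begin

definition curve_length :: "(real \<Rightarrow> 'a::euclidean_space) \<Rightarrow> real \<Rightarrow> real \<Rightarrow> ennreal" where
  "curve_length g a b =
     (SUP ts \<in> {ts. sorted ts \<and> set ts \<subseteq> {a..b}}.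
        ennreal (\<Sum>i < length ts - 1. dist (g (ts ! i)) (g (ts ! Suc i))))"

text \<open>A curve is a path g : [0,1] -> R^n; it is (locally) rectifiable iff its length is finite
  (for a closed parameter interval these notions coincide).\<close>
definition rectifiable_curve :: "(real \<Rightarrow> 'a::euclidean_space) \<Rightarrow> bool" where
  "rectifiable_curve g \<longleftrightarrow> path g \<and> curve_length g 0 1 < \<infinity>"

definition arclength_fun :: "(real \<Rightarrow> 'a::euclidean_space) \<Rightarrow> real \<Rightarrow> real" where
  "arclength_fun g t = enn2real (curve_length g 0 (min 1 (max 0 t)))"

definition line_integral :: "(real \<Rightarrow> 'a::euclidean_space) \<Rightarrow> ('a \<Rightarrow> ennreal) \<Rightarrow> ennreal" where
  "line_integral g \<rho> = (\<integral>\<^sup>+ t \<in> {0..1}. \<rho> (g t) \<partial>interval_measure (arclength_fun g))"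

definition annulus :: "real \<Rightarrow> real \<Rightarrow> 'a::euclidean_space set" where
  "annulus r1 r2 = {x. r1 < norm x \<and> norm x < r2}"

definition joining_curves :: "real \<Rightarrow> real \<Rightarrow> (real \<Rightarrow> 'a::euclidean_space) set" where
  "joining_curves r1 r2 = {g. path g \<and>
      ((norm (g 0) = r1 \<and> norm (g 1) = r2) \<or> (norm (g 0) = r2 \<and> norm (g 1) = r1)) \<and>
      (\<forall>t\<in>{0<..<1}. g t \<in> annulus r1 r2)}"

definition admissible :: "(real \<Rightarrow> 'a::euclidean_space) set \<Rightarrow> ('a \<Rightarrow> ennreal) \<Rightarrow> bool" where
  "admissible \<Gamma> \<rho> \<longleftrightarrow> \<rho> \<in> borel_measurable borel \<and>
     (\<forall>g\<in>\<Gamma>. rectifiable_curve g \<longrightarrow> line_integral g \<rho> \<ge> 1)"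

definition epow :: "ennreal \<Rightarrow> real \<Rightarrow> ennreal" where
  "epow x q = (if x = top then top else ennreal (enn2real x powr q))"

definition pmodulus :: "real \<Rightarrow> real \<Rightarrow> ('a::euclidean_space \<Rightarrow> real) \<Rightarrow> (real \<Rightarrow> 'a) set \<Rightarrow> ennreal" where
  "pmodulus r1 r2 q \<Gamma> =
     (INF \<rho> \<in> {\<rho>. admissible \<Gamma> \<rho>}. \<integral>\<^sup>+ x \<in> annulus r1 r2. epow (\<rho> x) (q x) \<partial>lborel)"

definition extremal_density ::
    "real \<Rightarrow> real \<Rightarrow> ('a::euclidean_space \<Rightarrow> real) \<Rightarrow> (real \<Rightarrow> 'a) set \<Rightarrow> ('a \<Rightarrow> ennreal) \<Rightarrow> bool" where
  "extremal_density r1 r2 q \<Gamma> \<rho> \<longleftrightarrow> admissible \<Gamma> \<rho> \<and>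
     (\<integral>\<^sup>+ x \<in> annulus r1 r2. epow (\<rho> x) (q x) \<partial>lborel) = pmodulus r1 r2 q \<Gamma>"

definition sphere_area :: "'a::euclidean_space itself \<Rightarrow> real" where
  "sphere_area _ = real DIM('a) * measure lborel (ball (0::'a) 1)"

definition rho_star :: "(real \<Rightarrow> real) \<Rightarrow> real \<Rightarrow> nat \<Rightarrow> real \<Rightarrow> real \<Rightarrow> real" where
  "rho_star p \<omega> n lam r = (lam / (p r * \<omega> * r ^ (n - 1))) powr (1 / (p r - 1))"

end

theory Submission
  imports Defs
begin

text \<open>Young's inequality in tangent form, \<open>t\<^sup>p \<ge> s\<^sup>p + p s\<^sup>p\<^sup>-\<^sup>1 (t - s)\<close> with equality only for \<open>t = s\<close>, is
  applied pointwise with \<open>s = \<rho>\<^sub>*(|x|)\<close>. The density \<open>\<rho>\<^sub>*\<close> is chosen so that the slope \<open>p s\<^sup>p\<^sup>-\<^sup>1\<close> equals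
  \<open>\<lambda> / (\<omega> |x|\<^sup>n\<^sup>-\<^sup>1)\<close>; hence integrating the linear term in polar coordinates leaves a mean over all
  directions of line integrals of \<open>\<rho>\<close> along radial segments, each at least 1 by admissibility.
  Conversely \<open>\<rho>\<^sub>*\<close> is admissible because arc length pushed forward by the norm along a joining
  curve dominates Lebesgue measure on \<open>(r\<^sub>1, r\<^sub>2)\<close>.\<close>

text \<open>Three obstacles shape the proof. The line integral is taken against
  \<open>interval_measure\<close>, which gives a half-open interval the increment of its integrator
  provided the latter is nondecreasing and right-continuous on the whole line; right-continuity of
  arc length is therefore established from the chains themselves. The norm along a joining curve may
  turn back, and tangential motion adds length, so the pushed-forward arc length can only be bounded
  from below. Densities may be infinite and subtraction in \<open>ennreal\<close> truncates, so the
  tangent inequality is carried as a comparison of sums. The constant \<open>lam\<close> is a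
  Lagrange multiplier: the linear term integrates to at least \<open>lam\<close> for an admissible
  density and to exactly \<open>lam\<close> for \<open>rho_density\<close>, hence it cancels. Equal
  energies then force equality almost everywhere in the tangent inequality, and strict convexity
  yields uniqueness up to null sets of the annulus. Existence and uniqueness of \<open>lam\<close>
  follow from the response of the normalising integral to a rescaling of \<open>lam\<close>.\<close>

subsection \<open>Arc length as a Stieltjes integrator\<close>

fun chain_length :: "('b \<Rightarrow> 'a::metric_space) \<Rightarrow> 'b list \<Rightarrow> real" where
  "chain_length g (s # t # ts) = dist (g s) (g t) + chain_length g (t # ts)"
| "chain_length g [s] = 0"
| "chain_length g [] = 0"

text \<open>Recursion on the list makes splitting and refining chains accessible to induction.
  Truncated subtraction in \<open>length ts - 1\<close> makes the sum empty for lists with fewer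
  than two entries, in agreement with the base cases.\<close>

lemma chain_length_eq_sum:
  "(\<Sum>i < length ts - 1. dist (g (ts ! i)) (g (ts ! Suc i))) = chain_length g ts"
  by (induction g ts rule: chain_length.induct) (simp_all add: sum.lessThan_Suc_shift del: sum.lessThan_Suc)

lemma chain_length_append:
  "chain_length g (us @ s # vs) = chain_length g (us @ [s]) + chain_length g (s # vs)"
proof (induction us)
  case (Cons u us)
  then show ?case by (cases us) simp_all
qed simp

lemma chain_length_Cons_ge: "chain_length g ts \<le> chain_length g (s # ts)"
  by (cases ts) auto

lemma chain_length_snoc_ge: "chain_length g ts \<le> chain_length g (ts @ [s])"
  by (induction g ts rule: chain_length.induct) auto

text \<open>Refinement lengthens a chain: the recursion walks to the junction, and only there is the
  triangle inequality applied.\<close>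

lemma chain_length_append_le_insert:
  "chain_length g (us @ vs) \<le> chain_length g (us @ s # vs)"
proof (induction us)
  case Nil
  then show ?case by (simp add: chain_length_Cons_ge)
next
  case (Cons u us)
  show ?case
  proof (cases us)
    case Nil
    then show ?thesis by (cases vs) (auto intro: dist_triangle)
  next
    case (Cons u' us')
    with Cons.IH show ?thesis by simp
  qed
qed

lemma curve_length_eq_SUP_chain_length:
  "curve_length g a b = (SUP ts \<in> {ts. sorted ts \<and> set ts \<subseteq> {a..b}}. ennreal (chain_length g ts))"
  by (simp only: curve_length_def chain_length_eq_sum)

lemma chain_length_le_curve_length:
  "sorted ts \<Longrightarrow> set ts \<subseteq> {a..b} \<Longrightarrow> ennreal (chain_length g ts) \<le> curve_length g a b"
  unfolding curve_length_eq_SUP_chain_length by (rule SUP_upper) auto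

lemma curve_length_mono: "b \<le> b' \<Longrightarrow> curve_length g a b \<le> curve_length g a b'"
  unfolding curve_length_eq_SUP_chain_length by (rule SUP_subset_mono) auto

section \<open>Arc length of a rectifiable curve as a real function\<close>

lemma arclength_fun_eq_enn2real:
  "0 \<le> t \<Longrightarrow> t \<le> 1 \<Longrightarrow> arclength_fun g t = enn2real (curve_length g 0 t)"
  by (simp add: arclength_fun_def)

lemma arclength_fun_clamp: "arclength_fun g t = arclength_fun g (min 1 (max 0 t))"
  by (simp add: arclength_fun_def)

context
  fixes g :: "real \<Rightarrow> 'a::euclidean_space"
  assumes rect: "rectifiable_curve g"
begin

text \<open>Since \<open>enn2real\<close> maps infinity to 0, finiteness of the total length is what
  prevents loss of information; afterwards the argument can stay in the reals.\<close>

lemma ennreal_arclength_fun: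
  assumes "0 \<le> t" "t \<le> 1"
  shows "ennreal (arclength_fun g t) = curve_length g 0 t"
proof -
  have "curve_length g 0 t < \<infinity>"
    using curve_length_mono[OF \<open>t \<le> 1\<close>, of g 0] rect unfolding rectifiable_curve_def by (auto elim: order.strict_trans1)
  then show ?thesis by (simp add: arclength_fun_eq_enn2real assms)
qed

lemma arclength_fun_nonneg: "0 \<le> arclength_fun g t"
  by (simp add: arclength_fun_def)

lemma chain_length_le_arclength_fun:
  assumes "0 \<le> t" "t \<le> 1" "sorted ts" "set ts \<subseteq> {0..t}"
  shows "chain_length g ts \<le> arclength_fun g t"
  using chain_length_le_curve_length[OF assms(3,4), of g] ennreal_arclength_fun[OF assms(1,2)]
  by (metis arclength_fun_nonneg ennreal_le_iff)

lemma arclength_fun_le: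
  assumes "0 \<le> t" "t \<le> 1" "\<And>ts. sorted ts \<Longrightarrow> set ts \<subseteq> {0..t} \<Longrightarrow> chain_length g ts \<le> K"
  shows "arclength_fun g t \<le> K"
proof -
  have "0 \<le> K" using assms(3)[of "[]"] by simp
  moreover have "ennreal (arclength_fun g t) \<le> ennreal K"
    unfolding ennreal_arclength_fun[OF assms(1,2)] curve_length_eq_SUP_chain_length
    using assms(3) by (intro SUP_least) (auto intro: ennreal_leI)
  ultimately show ?thesis by simp
qed

text \<open>Superadditivity: any chain on \<open>{0..s}\<close> followed by \<open>s # vs\<close> is
  a chain on \<open>{0..t}\<close>, and the supremum over the first piece is arc length up to
  \<open>s\<close>. Monotonicity, the distance bound and the right increment all derive from this
  direction of additivity.\<close>

lemma arclength_fun_add_chain_length_le: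
  assumes "0 \<le> s" "s \<le> t" "t \<le> 1" "sorted vs" "set vs \<subseteq> {s..t}"
  shows "arclength_fun g s + chain_length g (s # vs) \<le> arclength_fun g t"
proof -
  have "arclength_fun g s \<le> arclength_fun g t - chain_length g (s # vs)"
  proof (rule arclength_fun_le)
    fix ts assume ts: "sorted ts" "set ts \<subseteq> {0..s}"
    have "chain_length g (ts @ s # vs) \<le> arclength_fun g t"
      using ts assms by (intro chain_length_le_arclength_fun) (force simp: sorted_append)+
    then show "chain_length g ts \<le> arclength_fun g t - chain_length g (s # vs)"
      using chain_length_append[of g ts s vs] chain_length_snoc_ge[of g ts s] by simp
  qed (use assms in auto)
  then show ?thesis by simp
qed

lemma dist_le_arclength_fun_diff:
  assumes "0 \<le> s" "s \<le> t" "t \<le> 1"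
  shows "dist (g s) (g t) \<le> arclength_fun g t - arclength_fun g s"
  using arclength_fun_add_chain_length_le[of s t "[t]"] assms by simp

lemma arclength_fun_mono: "s \<le> t \<Longrightarrow> arclength_fun g s \<le> arclength_fun g t"
  using dist_le_arclength_fun_diff[of "min 1 (max 0 s)" "min 1 (max 0 t)"]
    zero_le_dist[of "g (min 1 (max 0 s))" "g (min 1 (max 0 t))"]
  unfolding arclength_fun_clamp[of g s] arclength_fun_clamp[of g t] by linarith

text \<open>A chain that nearly realises the total length is split at \<open>s\<close>; only its first step beyond
  \<open>s\<close> can contribute to the increment of the arc length immediately to the right of \<open>s\<close>.\<close>
lemma arclength_fun_right_increment:
  assumes s: "0 \<le> s" "s < 1" and e: "0 < e"
  obtains d where "s < d" "\<And>t. s < t \<Longrightarrow> t < d \<Longrightarrow> arclength_fun g t \<le> arclength_fun g s + e"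
proof -
  have "\<exists>ts. sorted ts \<and> set ts \<subseteq> {0..1} \<and> arclength_fun g 1 - e / 2 < chain_length g ts"
    using arclength_fun_le[of 1 "arclength_fun g 1 - e / 2"] e by force
  then obtain ts where ts: "sorted ts" "set ts \<subseteq> {0..1}"
    and big: "arclength_fun g 1 - e / 2 < chain_length g ts"
    by auto
  define us where "us = takeWhile (\<lambda>x. x \<le> s) ts"
  define vs where "vs = dropWhile (\<lambda>x. x \<le> s) ts"
  have ts_eq: "ts = us @ vs" by (simp add: us_def vs_def)
  have us: "sorted us" "set us \<subseteq> {0..s}"
  proof -
    show "sorted us" using ts by (simp add: us_def sorted_takeWhile)
    have "set us \<subseteq> set ts" "\<forall>x\<in>set us. x \<le> s"
      by (auto simp: us_def dest: set_takeWhileD)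
    with ts show "set us \<subseteq> {0..s}" by fastforce
  qed
  have vs: "sorted vs" "set vs \<subseteq> {s<..1}"
  proof -
    show "sorted vs" using ts by (simp add: vs_def sorted_dropWhile)
    show "set vs \<subseteq> {s<..1}"
    proof (cases vs)
      case (Cons v vs')
      then have "\<not> v \<le> s" unfolding vs_def by (metis hd_dropWhile list.discI list.sel(1))
      with Cons \<open>sorted vs\<close> ts(2) ts_eq show ?thesis by force
    qed simp
  qed
  have "continuous (at s within {0..1}) g"
    using rect s by (auto simp: rectifiable_curve_def path_def continuous_on_eq_continuous_within)
  then obtain d1 where d1: "0 < d1" "\<And>t. t \<in> {0..1} \<Longrightarrow> dist t s < d1 \<Longrightarrow> dist (g t) (g s) < e / 2"
    using e unfolding continuous_within_eps_delta by (metis half_gt_zero)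
  \<comment> \<open>Below \<open>d\<close> there is no vertex of the chain after \<open>s\<close>,
    \<open>g\<close> has moved by less than \<open>e / 2\<close>, and the parameter is still below
    1.\<close>
  define d where "d = Min (insert 1 (insert (s + d1) (set vs)))"
  have "s < d" using s d1 vs by (auto simp: d_def)
  moreover have "arclength_fun g t \<le> arclength_fun g s + e" if t: "s < t" "t < d" for t
  proof -
    have t1: "t < 1" "t < s + d1" "\<forall>v\<in>set vs. t < v" using t by (auto simp: d_def)
    \<comment> \<open>The chain after \<open>t\<close> is paid for by the arc length between
      \<open>t\<close> and 1. Cancelling it from a chain that misses the total by less than
      \<open>e / 2\<close> leaves arc length up to \<open>s\<close> plus one step of size at most
      \<open>e / 2\<close>.\<close>
    have "arclength_fun g t + chain_length g (t # vs) \<le> arclength_fun g 1"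
      using t t1 s vs by (intro arclength_fun_add_chain_length_le) force+
    also have "arclength_fun g 1 < chain_length g ts + e / 2" using big by simp
    also have "chain_length g ts \<le> chain_length g (us @ s # vs)"
      by (simp add: ts_eq chain_length_append_le_insert)
    also have "\<dots> \<le> chain_length g (us @ [s]) + chain_length g (s # t # vs)"
      using chain_length_append_le_insert[of g "[s]" vs t] by (subst chain_length_append) simp
    also have "chain_length g (us @ [s]) \<le> arclength_fun g s"
      using us s by (intro chain_length_le_arclength_fun) (force simp: sorted_append)+
    also have "chain_length g (s # t # vs) \<le> e / 2 + chain_length g (t # vs)"
      using d1(2)[of t] t t1 s by (simp add: dist_commute dist_real_def less_imp_le)
    finally show ?thesis by simp
  qed
  ultimately show thesis using that by blast
qed

text \<open>The property is required at every real point; outside \<open>{0..<1}\<close> the clamp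
  in \<open>arclength_fun\<close> makes the function constant immediately to the right.\<close>

lemma continuous_at_right_arclength_fun: "continuous (at_right s) (arclength_fun g)"
proof -
  consider "s < 0" | "0 \<le> s" "s < 1" | "1 \<le> s" by linarith
  then show ?thesis
  proof cases
    case 1
    have "\<forall>\<^sub>F t in at_right s. arclength_fun g t = arclength_fun g s"
      using eventually_at_right_real[OF 1] by eventually_elim (use 1 in \<open>simp add: arclength_fun_def\<close>)
    then show ?thesis unfolding continuous_within by (rule tendsto_eventually)
  next
    case 2
    show ?thesis unfolding continuous_within
    proof (rule tendstoI)
      fix e :: real assume "0 < e"
      then obtain d where d: "s < d"
        "\<And>t. s < t \<Longrightarrow> t < d \<Longrightarrow> arclength_fun g t \<le> arclength_fun g s + e / 2"
        using arclength_fun_right_increment[OF 2, of "e / 2"] by auto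
      show "\<forall>\<^sub>F t in at_right s. dist (arclength_fun g t) (arclength_fun g s) < e"
        using eventually_at_right_real[OF d(1)]
      proof eventually_elim
        case (elim t)
        then show ?case using d(2)[of t] arclength_fun_mono[of s t] \<open>0 < e\<close> by (auto simp: dist_real_def)
      qed
    qed
  next
    case 3
    have "\<forall>\<^sub>F t in at_right s. arclength_fun g t = arclength_fun g s"
      using eventually_at_right_less[of s] by eventually_elim (use 3 in \<open>simp add: arclength_fun_def\<close>)
    then show ?thesis unfolding continuous_within by (rule tendsto_eventually)
  qed
qed

lemma emeasure_interval_measure_arclength_fun:
  "a \<le> b \<Longrightarrow> emeasure (interval_measure (arclength_fun g)) {a<..b} = arclength_fun g b - arclength_fun g a"
  by (intro emeasure_interval_measure_Ioc arclength_fun_mono continuous_at_right_arclength_fun)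

end

subsection \<open>Radial functions along joining curves\<close>

text \<open>\<open>t2\<close> is the first time at level \<open>d\<close> and \<open>t1\<close> the
  last time at level \<open>c\<close> before it, both attained by compactness. Leaving the band in
  between would, by the intermediate value theorem, produce a later visit to \<open>c\<close> or an
  earlier one to \<open>d\<close>.\<close>

lemma continuous_crossing:
  fixes h :: "real \<Rightarrow> real"
  assumes h: "continuous_on {0..1} h" and c: "h 0 \<le> c" "c < d" "d \<le> h 1"
  obtains t1 t2 where "0 \<le> t1" "t1 < t2" "t2 \<le> 1" "h t1 = c" "h t2 = d"
    "h ` {t1<..<t2} \<subseteq> {c<..<d}"
proof -
  have cl: "compact {t\<in>{u..v}. h t = k}" if "0 \<le> u" "v \<le> 1" for u v k
  proof -
    have "closed ({u..v} \<inter> h -` {k})"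
      using that by (intro continuous_closed_preimage continuous_on_subset[OF h]) auto
    then have "compact ({u..v} \<inter> ({u..v} \<inter> h -` {k}))" by (intro compact_Int_closed) auto
    also have "{u..v} \<inter> ({u..v} \<inter> h -` {k}) = {t\<in>{u..v}. h t = k}" by auto
    finally show ?thesis .
  qed
  have IV: "\<exists>t\<in>{u..v}. h t = k" if "0 \<le> u" "u \<le> v" "v \<le> 1" "h u \<le> k" "k \<le> h v" for u v k
    using IVT'[of h u k v] that continuous_on_subset[OF h, of "{u..v}"] by auto
  have "{t\<in>{0..1}. h t = d} \<noteq> {}" using IV[of 0 1 d] c by auto
  then obtain t2 where t2: "t2 \<in> {0..1}" "h t2 = d" "\<And>t. t \<in> {0..1} \<Longrightarrow> h t = d \<Longrightarrow> t2 \<le> t"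
    using compact_attains_inf[OF cl[of 0 1 d]] by auto
  have "{t\<in>{0..t2}. h t = c} \<noteq> {}" using IV[of 0 t2 c] c t2 by auto
  then obtain t1 where t1: "t1 \<in> {0..t2}" "h t1 = c" "\<And>t. t \<in> {0..t2} \<Longrightarrow> h t = c \<Longrightarrow> t \<le> t1"
    using compact_attains_sup[OF cl[of 0 t2 c]] t2 by auto
  show thesis
  proof
    show "t1 < t2" using t1 t2 c by (cases "t1 = t2") auto
    have "c < h t \<and> h t < d" if t: "t1 < t" "t < t2" for t
    proof (intro conjI; rule ccontr)
      assume "\<not> c < h t"
      then obtain t' where "t' \<in> {t..t2}" "h t' = c" using IV[of t t2 c] t t1 t2 c by auto
      moreover from this have "t' \<le> t1" using t t1(1) by (intro t1(3)) auto
      ultimately show False using t by auto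
    next
      assume "\<not> h t < d"
      then obtain t' where "t' \<in> {t1..t}" "h t' = d" using IV[of t1 t d] t t1 t2 c by auto
      moreover from this have "t2 \<le> t'" using t t1(1) t2(1) by (intro t2(3)) auto
      ultimately show False using t by auto
    qed
    then show "h ` {t1<..<t2} \<subseteq> {c<..<d}" by auto
  qed (use t1 t2 in auto)
qed

text \<open>On a crossing the increment of \<open>F\<close> dominates that of \<open>h\<close>. The
  measure is known on half-open intervals, so the open crossing interval is approached by
  \<open>{t1<..s}\<close>; as \<open>s\<close> increases to \<open>t2\<close>, left-continuity of
  \<open>h\<close> recovers the full \<open>d - c\<close>.\<close>

lemma emeasure_interval_measure_vimage_ge:
  fixes F h :: "real \<Rightarrow> real"
  assumes F: "\<And>a b. a \<le> b \<Longrightarrow> emeasure (interval_measure F) {a<..b} = F b - F a"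
    and h: "continuous_on {0..1} h"
    and hF: "\<And>s t. 0 \<le> s \<Longrightarrow> s \<le> t \<Longrightarrow> t \<le> 1 \<Longrightarrow> h t - h s \<le> F t - F s"
    and c: "h 0 \<le> c" "c < d" "d \<le> h 1"
  shows "ennreal (d - c) \<le> emeasure (interval_measure F) {t\<in>{0..1}. h t \<in> {c<..<d}}"
proof -
  obtain t1 t2 where t: "0 \<le> t1" "t1 < t2" "t2 \<le> 1" "h t1 = c" "h t2 = d"
    "h ` {t1<..<t2} \<subseteq> {c<..<d}"
    using continuous_crossing[OF h c] .
  have sets: "{t\<in>{0..1}. h t \<in> {c<..<d}} \<in> sets borel"
  proof -
    have "h \<in> borel_measurable (restrict_space borel {0..1})"
      by (rule borel_measurable_continuous_on_restrict[OF h])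
    then have "h -` {c<..<d} \<inter> space (restrict_space borel {0..1}) \<in> sets (restrict_space borel {0..1})"
      by (rule measurable_sets) simp
    also have "h -` {c<..<d} \<inter> space (restrict_space borel {0..1}) = {t\<in>{0..1}. h t \<in> {c<..<d}}"
      by (auto simp: space_restrict_space)
    finally show ?thesis by (simp add: sets_restrict_space_iff)
  qed
  have "(h \<longlongrightarrow> h t2) (at_left t2)"
    using t by (intro continuous_on_Icc_at_leftD[of t1] continuous_on_subset[OF h]) auto
  then have "((\<lambda>t. ennreal (h t - c)) \<longlongrightarrow> ennreal (d - c)) (at_left t2)"
    using t by (intro tendsto_ennrealI tendsto_diff) auto
  moreover have "\<forall>\<^sub>F t in at_left t2. ennreal (h t - c) \<le> emeasure (interval_measure F) {t\<in>{0..1}. h t \<in> {c<..<d}}"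
    using eventually_at_left_real[OF \<open>t1 < t2\<close>]
  proof eventually_elim
    case (elim s)
    have "ennreal (h s - c) \<le> ennreal (F s - F t1)"
      using hF[of t1 s] elim t by (intro ennreal_leI) auto
    also have "\<dots> = emeasure (interval_measure F) {t1<..s}" using elim by (simp add: F)
    also have "\<dots> \<le> emeasure (interval_measure F) {t\<in>{0..1}. h t \<in> {c<..<d}}"
      using t elim sets by (intro emeasure_mono) (auto simp: image_subset_iff)
    finally show ?case .
  qed
  ultimately show ?thesis by (rule tendsto_upperbound) simp
qed

text \<open>An open subset of \<open>{a<..<b}\<close> is a countable disjoint union of intervals, so the hypothesis
  extends to open sets, and then to Borel sets by outer regularity.\<close>
lemma emeasure_lborel_le_of_intervals:
  fixes N :: "real measure"
  assumes sets_N: "sets N = sets borel" and fin: "emeasure N UNIV \<noteq> \<infinity>"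
    and N: "\<And>c d. a \<le> c \<Longrightarrow> c < d \<Longrightarrow> d \<le> b \<Longrightarrow> ennreal (d - c) \<le> emeasure N {c<..<d}"
    and E: "E \<in> sets borel" "E \<subseteq> {a<..<b}"
  shows "emeasure lborel E \<le> emeasure N E"
proof -
  have space_N: "space N = UNIV" using sets_eq_imp_space_eq[OF sets_N] by simp
  have conn: "emeasure lborel C \<le> emeasure N C"
    if C: "open C" "connected C" "C \<subseteq> {a<..<b}" "C \<noteq> {}" for C
  proof -
    have bdd: "bdd_above C" "bdd_below C"
      using C(3) by (auto intro: bdd_above_mono[OF bdd_above_Ioo] bdd_below_mono[OF bdd_below_Ioo])
    have "C \<subseteq> {Inf C..Sup C}" using bdd by (auto intro: cInf_lower cSup_upper)
    then have "emeasure lborel C \<le> emeasure lborel {Inf C..Sup C}" by (intro emeasure_mono) auto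
    also have "\<dots> = ennreal (Sup C - Inf C)"
      using cInf_le_cSup[OF C(4) bdd] by simp
    also have "\<dots> \<le> emeasure N C"
    proof (rule ennreal_le_epsilon)
      fix e :: real assume e: "0 < e"
      \<comment> \<open>The end points of \<open>C\<close> are approached from inside, so that
        \<open>N\<close> applies to an interval within \<open>C\<close>. If the two points come in
        the wrong order, \<open>C\<close> is shorter than \<open>e\<close> and the bound is
        trivial.\<close>
      obtain x where x: "x \<in> C" "x < Inf C + e / 2" using cInf_lessD[OF C(4), of "Inf C + e / 2"] e by auto
      obtain y where y: "y \<in> C" "Sup C - e / 2 < y" using less_cSupD[OF C(4), of "Sup C - e / 2"] e by auto
      show "ennreal (Sup C - Inf C) \<le> emeasure N C + ennreal e"
      proof (cases "x < y")
        case True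
        have "{x..y} \<subseteq> C" using connected_contains_Icc[OF C(2) x(1) y(1)] .
        then have "emeasure N {x<..<y} \<le> emeasure N C"
          using C(1) by (intro emeasure_mono) (auto simp: sets_N)
        moreover have "ennreal (y - x) \<le> emeasure N {x<..<y}"
          using True x y C(3) by (intro N) auto
        moreover have "ennreal (Sup C - Inf C) \<le> ennreal (y - x) + ennreal e"
          using x y e True by (subst ennreal_plus[symmetric]) (simp_all add: ennreal_leI del: ennreal_plus)
        ultimately show ?thesis by (meson add_right_mono order_trans)
      next
        case False
        then have "ennreal (Sup C - Inf C) \<le> ennreal e" using x y by (intro ennreal_leI) auto
        then show ?thesis by (simp add: add_increasing)
      qed
    qed
    finally show ?thesis .
  qed
  have opn: "emeasure lborel U \<le> emeasure N U" if U: "open U" "U \<subseteq> {a<..<b}" for U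
  proof -
    let ?C = "components U"
    have oC: "open C" if "C \<in> ?C" for C using open_components[OF U(1) that] .
    have cnt: "countable ?C"
      using oC pairwise_disjoint_components[of U] by (intro countable_disjoint_open_subsets)
        (auto simp: pairwise_def disjnt_def)
    have disj: "disjoint_family_on (\<lambda>C. C) ?C"
      using components_nonoverlap by (auto simp: disjoint_family_on_def)
    have "emeasure lborel U = emeasure lborel (\<Union>C\<in>?C. C)" by simp
    also have "\<dots> = (\<integral>\<^sup>+ C. emeasure lborel C \<partial>count_space ?C)"
      using oC by (intro emeasure_UN_countable cnt disj) auto
    also have "\<dots> \<le> (\<integral>\<^sup>+ C. emeasure N C \<partial>count_space ?C)"
    proof (rule nn_integral_mono)
      fix C assume "C \<in> space (count_space ?C)"
      then have "C \<in> ?C" by simp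
      then show "emeasure lborel C \<le> emeasure N C"
        using oC U in_components_connected in_components_nonempty in_components_subset by (intro conn) blast+
    qed
    also have "\<dots> = emeasure N (\<Union>C\<in>?C. C)"
      using oC by (intro emeasure_UN_countable[symmetric] cnt disj) (auto simp: sets_N)
    finally show ?thesis by simp
  qed
  have "emeasure lborel E \<le> (INF U \<in> {U. E \<subseteq> U \<and> open U}. emeasure N U)"
  proof (rule INF_greatest)
    fix U assume "U \<in> {U. E \<subseteq> U \<and> open U}"
    then have U: "E \<subseteq> U" "open U" by auto
    \<comment> \<open>An outer approximation may stick out of \<open>{a<..<b}\<close>, where nothing
      is known about \<open>N\<close>, so it is cut back first.\<close>
    have "emeasure lborel E \<le> emeasure lborel (U \<inter> {a<..<b})" using U E by (intro emeasure_mono) auto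
    also have "\<dots> \<le> emeasure N (U \<inter> {a<..<b})" using U by (intro opn) auto
    also have "\<dots> \<le> emeasure N U" using U by (intro emeasure_mono) (auto simp: sets_N)
    finally show "emeasure lborel E \<le> emeasure N U" .
  qed
  also have "\<dots> = emeasure N E"
    using outer_regular[OF sets_N _ E(1)] fin space_N by simp
  finally show ?thesis .
qed

text \<open>Encoding the interval as a density keeps both measures on the Borel sets of the whole
  line, where they can be compared by \<open>le_measure\<close> and the comparison passes to
  integrals.\<close>

lemma nn_integral_lborel_le_of_intervals:
  fixes N :: "real measure"
  assumes sets_N: "sets N = sets borel" and fin: "emeasure N UNIV \<noteq> \<infinity>"
    and N: "\<And>c d. a \<le> c \<Longrightarrow> c < d \<Longrightarrow> d \<le> b \<Longrightarrow> ennreal (d - c) \<le> emeasure N {c<..<d}"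
    and f[measurable]: "f \<in> borel_measurable borel"
  shows "(\<integral>\<^sup>+ x \<in> {a<..<b}. f x \<partial>lborel) \<le> (\<integral>\<^sup>+ x. f x \<partial>N)"
proof -
  let ?D = "density lborel (indicator {a<..<b})"
  have space_N: "space N = UNIV" using sets_eq_imp_space_eq[OF sets_N] by simp
  have "?D \<le> N"
  proof (rule le_measure[THEN iffD2, rule_format])
    fix E assume "E \<in> sets ?D"
    then have E: "E \<in> sets borel" by simp
    have "emeasure ?D E = (\<integral>\<^sup>+ x. indicator (E \<inter> {a<..<b}) x \<partial>lborel)"
      using E by (subst emeasure_density) (auto intro!: nn_integral_cong split: split_indicator simp del: nn_integral_indicator)
    also have "\<dots> = emeasure lborel (E \<inter> {a<..<b})" using E by (intro nn_integral_indicator) auto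
    also have "\<dots> \<le> emeasure N (E \<inter> {a<..<b})"
      using E by (intro emeasure_lborel_le_of_intervals[OF sets_N fin N]) auto
    also have "\<dots> \<le> emeasure N E" using E by (intro emeasure_mono) (auto simp: sets_N)
    finally show "emeasure ?D E \<le> emeasure N E" .
  qed (simp add: sets_N)
  then have "nn_integral ?D f \<le> nn_integral N f"
    by (intro nn_integral_mono_measure) (simp add: sets_N)
  then show ?thesis by (simp add: nn_integral_density mult.commute)
qed

text \<open>Two facts about the curve suffice: the norm is 1-Lipschitz, so its increments are
  bounded by those of arc length, and by continuity it crosses every subinterval of
  \<open>{r1<..<r2}\<close>.\<close>

lemma line_integral_norm_ge:
  fixes g :: "real \<Rightarrow> 'a::euclidean_space"
  assumes g: "g \<in> joining_curves r1 r2" and rect: "rectifiable_curve g" and r: "r1 < r2"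
    and [measurable]: "f \<in> borel_measurable borel"
  shows "(\<integral>\<^sup>+ r \<in> {r1<..<r2}. f r \<partial>lborel) \<le> line_integral g (\<lambda>x. f (norm x))"
proof -
  let ?F = "arclength_fun g"
  let ?I = "interval_measure ?F"
  let ?R = "restrict_space ?I {0..1}"
  let ?h = "\<lambda>t. norm (g t)"
  let ?N = "distr ?R borel ?h"
  have cont: "continuous_on {0..1} ?h"
    using rect by (auto simp: rectifiable_curve_def path_def intro: continuous_intros)
  have [measurable]: "?h \<in> borel_measurable ?R"
    using borel_measurable_continuous_on_restrict[OF cont]
    by (subst measurable_cong_sets[OF sets_restrict_space_cong[OF sets_interval_measure] refl])
  have F: "emeasure ?I {a<..b} = ?F b - ?F a" if "a \<le> b" for a b
    using emeasure_interval_measure_arclength_fun[OF rect that] .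
  have lip: "\<bar>?h t - ?h s\<bar> \<le> ?F t - ?F s" if "0 \<le> s" "s \<le> t" "t \<le> 1" for s t
    using dist_le_arclength_fun_diff[OF rect that] norm_triangle_ineq3[of "g t" "g s"]
    by (simp add: dist_norm norm_minus_commute)
  have em: "emeasure ?N E = emeasure ?I {t\<in>{0..1}. ?h t \<in> E}" if "E \<in> sets borel" for E
  proof -
    have "emeasure ?N E = emeasure ?R {t\<in>{0..1}. ?h t \<in> E}"
      using that by (subst emeasure_distr) (auto simp: space_restrict_space intro!: arg_cong[where f="emeasure ?R"])
    also have "\<dots> = emeasure ?I {t\<in>{0..1}. ?h t \<in> E}" by (subst emeasure_restrict_space) auto
    finally show ?thesis .
  qed
  \<comment> \<open>The half-open interval starts at -1 because it has to contain the parameter 0;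
    the clamp makes arc length 0 there.\<close>
  have "emeasure ?N UNIV \<le> emeasure ?I {-1<..1}"
    by (subst em) (auto intro!: emeasure_mono)
  also have "\<dots> < \<infinity>" by (simp add: F)
  finally have fin: "emeasure ?N UNIV \<noteq> \<infinity>" by simp
  have ge: "ennreal (d - c) \<le> emeasure ?N {c<..<d}" if c: "r1 \<le> c" "c < d" "d \<le> r2" for c d
  proof -
    from g consider "?h 0 = r1" "?h 1 = r2" | "?h 0 = r2" "?h 1 = r1"
      by (auto simp: joining_curves_def)
    then show ?thesis
    proof cases
      case 1
      then have "ennreal (d - c) \<le> emeasure ?I {t\<in>{0..1}. ?h t \<in> {c<..<d}}"
        using c lip by (intro emeasure_interval_measure_vimage_ge[OF F cont]) (auto simp: abs_le_iff)
      then show ?thesis by (subst em) auto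
    next
      case 2
      \<comment> \<open>A curve running inwards is reduced to the increasing case: its negated norm
        climbs from \<open>- r2\<close> to \<open>- r1\<close>.\<close>
      have "ennreal (- c - (- d)) \<le> emeasure ?I {t\<in>{0..1}. - ?h t \<in> {- d<..<- c}}"
        using c lip 2 by (intro emeasure_interval_measure_vimage_ge[OF F continuous_on_minus[OF cont]])
          (auto simp: abs_le_iff)
      also have "{t\<in>{0..1}. - ?h t \<in> {- d<..<- c}} = {t\<in>{0..1}. ?h t \<in> {c<..<d}}" by auto
      finally show ?thesis by (subst em) auto
    qed
  qed
  have "(\<integral>\<^sup>+ r \<in> {r1<..<r2}. f r \<partial>lborel) \<le> (\<integral>\<^sup>+ r. f r \<partial>?N)"
    by (rule nn_integral_lborel_le_of_intervals[OF _ fin ge]) auto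
  also have "\<dots> = line_integral g (\<lambda>x. f (norm x))"
    by (simp add: nn_integral_distr nn_integral_restrict_space line_integral_def)
  finally show ?thesis .
qed

subsection \<open>Radial segments\<close>

lemma chain_length_radial_segment:
  assumes u: "norm u = 1" and k: "0 \<le> k" and ts: "sorted (t # ts)"
  shows "chain_length (\<lambda>t. (a + k * t) *\<^sub>R u) (t # ts) = k * (last (t # ts) - t)"
  using ts
proof (induction ts arbitrary: t)
  case (Cons s ts)
  have "dist ((a + k * t) *\<^sub>R u) ((a + k * s) *\<^sub>R u) = k * (s - t)"
  proof -
    have "dist ((a + k * t) *\<^sub>R u) ((a + k * s) *\<^sub>R u) = norm ((k * (t - s)) *\<^sub>R u)"
      by (simp add: dist_norm scaleR_left_diff_distrib[symmetric] algebra_simps del: scaleR_left_diff_distrib)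
    then show ?thesis using Cons.prems u k by (simp add: abs_mult)
  qed
  moreover have "chain_length (\<lambda>t. (a + k * t) *\<^sub>R u) (s # ts) = k * (last (s # ts) - s)"
    using Cons.prems by (intro Cons.IH) auto
  ultimately have "chain_length (\<lambda>t. (a + k * t) *\<^sub>R u) (t # s # ts) = k * (s - t) + k * (last (s # ts) - s)"
    by (simp only: chain_length.simps)
  also have "\<dots> = k * (last (t # s # ts) - t)" by (simp add: algebra_simps)
  finally show ?case .
qed simp

lemma curve_length_radial_segment:
  assumes u: "norm u = 1" and k: "0 \<le> k" and t: "0 \<le> t"
  shows "curve_length (\<lambda>t. (a + k * t) *\<^sub>R u) 0 t = ennreal (k * t)"
proof (rule antisym)
  show "curve_length (\<lambda>t. (a + k * t) *\<^sub>R u) 0 t \<le> ennreal (k * t)"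
    unfolding curve_length_eq_SUP_chain_length
  proof (rule SUP_least)
    fix ts assume ts: "ts \<in> {ts. sorted ts \<and> set ts \<subseteq> {0..t}}"
    show "ennreal (chain_length (\<lambda>t. (a + k * t) *\<^sub>R u) ts) \<le> ennreal (k * t)"
    proof (cases ts)
      case (Cons s ss)
      have "last ts \<in> set ts" using Cons by simp
      then have "last ts - s \<le> t" using ts Cons by force
      then have "k * (last ts - s) \<le> k * t" using k by (rule mult_left_mono)
      then show ?thesis
        using ts Cons chain_length_radial_segment[OF u k, of s ss a] by (auto intro!: ennreal_leI)
    qed (use k t in simp)
  qed
  show "ennreal (k * t) \<le> curve_length (\<lambda>t. (a + k * t) *\<^sub>R u) 0 t"
    using chain_length_le_curve_length[of "[0, t]" 0 t "\<lambda>t. (a + k * t) *\<^sub>R u"] t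
      chain_length_radial_segment[OF u k, of 0 "[t]" a] by simp
qed

text \<open>Prepares a comparison of Borel measures on rays. Beyond \<open>c\<close> the integrator
  is constant, so all intervals in the exhaustion of the ray carry the same mass.\<close>

lemma emeasure_interval_measure_Ioi:
  assumes mono_F: "\<And>x y. x \<le> y \<Longrightarrow> F x \<le> F y"
    and right_cont_F: "\<And>a. continuous (at_right a) F"
    and const: "\<And>x. c \<le> x \<Longrightarrow> F x = F c"
  shows "emeasure (interval_measure F) {a<..} = ennreal (F (max a c) - F a)"
proof -
  have "incseq (\<lambda>n::nat. {a<..max a c + real n})" by (auto simp: incseq_def)
  then have "(\<lambda>n. emeasure (interval_measure F) {a<..max a c + real n}) \<longlonglongrightarrow> emeasure (interval_measure F) (\<Union>n. {a<..max a c + real n})"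
    by (intro Lim_emeasure_incseq) auto
  moreover have "(\<Union>n. {a<..max a c + real n}) = {a<..}"
  proof -
    have "\<exists>n. x \<le> max a c + real n" for x
      using real_arch_simple[of "x - max a c"] by (auto simp: algebra_simps)
    then show ?thesis by auto
  qed
  moreover have "emeasure (interval_measure F) {a<..max a c + real n} = ennreal (F (max a c) - F a)" for n
  proof -
    have "F (max a c + real n) = F (max a c)" using const[of "max a c + real n"] const[of "max a c"] by simp
    moreover have "emeasure (interval_measure F) {a<..max a c + real n} = ennreal (F (max a c + real n) - F a)"
      by (intro emeasure_interval_measure_Ioc mono_F right_cont_F) simp
    ultimately show ?thesis by simp
  qed
  ultimately show ?thesis by (simp add: LIMSEQ_const_iff)
qed

text \<open>Arc length of a radial segment is a clamped linear function; this identifies its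
  Stieltjes measure with scaled Lebesgue measure, turning the line integral into an ordinary
  one.\<close>

lemma interval_measure_clamp:
  assumes k: "0 \<le> k"
  shows "interval_measure (\<lambda>t. k * min 1 (max 0 t)) = density lborel (\<lambda>t. ennreal k * indicator {0..1} t)"
proof (rule measure_eqI_lessThan)
  let ?F = "\<lambda>t::real. k * min 1 (max 0 t)"
  let ?D = "density lborel (\<lambda>t::real. ennreal k * indicator {0..1} t)"
  have cont: "continuous (at_right a) ?F" for a
  proof -
    have "continuous_on UNIV ?F" by (intro continuous_intros)
    then show ?thesis by (meson UNIV_I continuous_on_eq_continuous_at continuous_at_imp_continuous_at_within open_UNIV)
  qed
  have *: "emeasure (interval_measure ?F) {a<..} = ennreal (?F (max a 1) - ?F a)" for a
    by (rule emeasure_interval_measure_Ioi) (use k cont in \<open>auto intro!: mult_left_mono\<close>)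
  show "emeasure (interval_measure ?F) {a<..} < \<infinity>" for a by (simp add: *)
  show "emeasure (interval_measure ?F) {a<..} = emeasure ?D {a<..}" for a
  proof -
    \<comment> \<open>Holds up to null sets: the left end point is added, and for
      \<open>a \<ge> 1\<close> the interval degenerates to the point 1 instead of being
      empty.\<close>
    have "emeasure ?D {a<..} = (\<integral>\<^sup>+ t. ennreal k * indicator {min 1 (max 0 a)..1} t \<partial>lborel)"
      by (subst emeasure_density, simp, simp, rule nn_integral_cong_AE,
          use AE_lborel_singleton[of a] AE_lborel_singleton[of 1] in eventually_elim) (auto split: split_indicator)
    also have "\<dots> = ennreal k * ennreal (1 - min 1 (max 0 a))"
      by (subst nn_integral_cmult) auto
    also have "\<dots> = ennreal (?F (max a 1) - ?F a)"
      using k by (subst ennreal_mult[symmetric]) (auto simp: algebra_simps)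
    finally show ?thesis by (simp add: *)
  qed
qed auto

lemma rectifiable_curve_radial_segment:
  assumes u: "norm u = 1" and k: "0 \<le> k"
  shows "rectifiable_curve (\<lambda>t. (a + k * t) *\<^sub>R u)"
  using curve_length_radial_segment[OF assms, of 1 a]
  by (auto simp: rectifiable_curve_def path_def intro!: continuous_intros)

lemma line_integral_radial_segment:
  fixes u :: "'a::euclidean_space" and \<rho> :: "'a \<Rightarrow> ennreal"
  assumes u: "norm u = 1" and ab: "a < b" and [measurable]: "\<rho> \<in> borel_measurable borel"
  shows "line_integral (\<lambda>t. (a + (b - a) * t) *\<^sub>R u) \<rho> = (\<integral>\<^sup>+ r \<in> {a<..<b}. \<rho> (r *\<^sub>R u) \<partial>lborel)"
proof -
  let ?g = "\<lambda>t. (a + (b - a) * t) *\<^sub>R u"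
  have "arclength_fun ?g = (\<lambda>t. (b - a) * min 1 (max 0 t))"
    using ab by (simp add: fun_eq_iff arclength_fun_def curve_length_radial_segment[OF u])
  then have "line_integral ?g \<rho>
      = (\<integral>\<^sup>+ t. ennreal (b - a) * indicator {0..1} t * (\<rho> (?g t) * indicator {0..1} t) \<partial>lborel)"
    using ab by (simp add: line_integral_def interval_measure_clamp nn_integral_density)
  also have "\<dots> = (\<integral>\<^sup>+ t. ennreal (b - a) * (\<rho> (?g t) * indicator {a<..<b} (a + (b - a) * t)) \<partial>lborel)"
  proof (rule nn_integral_cong_AE, use AE_lborel_singleton[of 0] AE_lborel_singleton[of 1] in eventually_elim)
    case (elim t)
    have "a + (b - a) * t < b \<longleftrightarrow> (b - a) * t < (b - a) * 1" by auto
    also have "\<dots> \<longleftrightarrow> t < 1" using ab by (subst mult_less_cancel_left_pos) auto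
    finally have "a + (b - a) * t \<in> {a<..<b} \<longleftrightarrow> t \<in> {0<..<1}"
      using ab by (auto simp: zero_less_mult_iff)
    then show ?case using elim by (auto split: split_indicator)
  qed
  also have "\<dots> = ennreal (b - a) * (\<integral>\<^sup>+ t. \<rho> (?g t) * indicator {a<..<b} (a + (b - a) * t) \<partial>lborel)"
    by (rule nn_integral_cmult) simp
  also have "\<dots> = (\<integral>\<^sup>+ r \<in> {a<..<b}. \<rho> (r *\<^sub>R u) \<partial>lborel)"
    using ab by (subst (2) nn_integral_real_affine[where c="b - a" and t=a]) auto
  finally show ?thesis .
qed

lemma radial_segment_in_joining_curves:
  assumes u: "norm u = 1" and r: "0 < r1" "r1 < r2"
  shows "(\<lambda>t. (r1 + (r2 - r1) * t) *\<^sub>R u) \<in> joining_curves r1 r2"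
proof -
  have "r1 < \<bar>r1 + (r2 - r1) * t\<bar> \<and> \<bar>r1 + (r2 - r1) * t\<bar> < r2" if "0 < t" "t < 1" for t
  proof -
    have "(r2 - r1) * t < r2 - r1" "0 < (r2 - r1) * t"
      using mult_strict_left_mono[OF \<open>t < 1\<close>, of "r2 - r1"] mult_pos_pos[of "r2 - r1" t] that r by auto
    with r show ?thesis by linarith
  qed
  then show ?thesis
    using u r by (auto simp: joining_curves_def annulus_def path_def intro!: continuous_intros)
qed

subsection \<open>Polar coordinates\<close>

lemma nn_integral_lborel_scaleR:
  fixes f :: "'a::euclidean_space \<Rightarrow> ennreal"
  assumes [measurable]: "f \<in> borel_measurable borel" and c: "c > 0"
  shows "(\<integral>\<^sup>+ x. f (c *\<^sub>R x) \<partial>lborel) = ennreal (inverse (c ^ DIM('a))) * (\<integral>\<^sup>+ x. f x \<partial>lborel)"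
proof -
  have "(\<integral>\<^sup>+ x. f x \<partial>lborel)
      = (\<integral>\<^sup>+ x. f x \<partial>density (distr lborel borel (\<lambda>x. 0 + c *\<^sub>R x)) (\<lambda>_. ennreal (\<bar>c\<bar> ^ DIM('a))))"
    using c by (subst lborel_affine[of c 0]) auto
  also have "\<dots> = ennreal (c ^ DIM('a)) * (\<integral>\<^sup>+ x. f (c *\<^sub>R x) \<partial>lborel)"
    using c by (simp add: nn_integral_density nn_integral_distr nn_integral_cmult)
  finally show ?thesis
    using c by (simp add: mult.assoc[symmetric] ennreal_mult[symmetric])
qed

lemma nn_integral_inverse_power_tail:
  assumes a: "0 < (a::real)" and n: "0 < n"
  shows "(\<integral>\<^sup>+ t. ennreal (inverse (t ^ Suc n)) * indicator {a..} t \<partial>lborel) = ennreal (inverse (real n * a ^ n))"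
proof -
  have "(\<integral>\<^sup>+ t. ennreal (inverse (t ^ Suc n)) * indicator {a..} t \<partial>lborel)
      = ennreal (0 - (- inverse (real n * a ^ n)))"
  proof (rule nn_integral_FTC_atLeast)
    fix x assume "a \<le> x"
    then have x: "0 < x" using a by simp
    \<comment> \<open>Naming this power removes the truncated exponent, so that
      \<open>field_simps\<close> can cancel.\<close>
    define y where "y = x ^ (n - 1)"
    have y: "x ^ n = x * y" "0 < y" using x n power_Suc[of x "n - 1"] by (simp_all add: y_def)
    have "((\<lambda>t. real n * t ^ n) has_real_derivative real n * (real n * y)) (at x)"
      using DERIV_cmult[OF DERIV_pow[of n x], of "real n"] by (simp add: y_def)
    from DERIV_minus[OF DERIV_inverse_fun[OF this]] x n
    have "((\<lambda>t. - inverse (real n * t ^ n)) has_real_derivative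
        - (- (real n * (real n * y) * inverse ((real n * x ^ n) ^ Suc (Suc 0))))) (at x)" by simp
    also have "- (- (real n * (real n * y) * inverse ((real n * x ^ n) ^ Suc (Suc 0)))) = inverse (x ^ Suc n)"
      using x n y by (simp add: field_simps)
    finally show "((\<lambda>t. - inverse (real n * t ^ n)) has_real_derivative inverse (x ^ Suc n)) (at x)" .
  next
    have "filterlim (\<lambda>t. real n * t ^ n) at_infinity at_top"
      using n by (intro filterlim_at_top_imp_at_infinity filterlim_tendsto_pos_mult_at_top[OF tendsto_const]
          filterlim_pow_at_top filterlim_ident) auto
    then have "((\<lambda>t. inverse (real n * t ^ n)) \<longlongrightarrow> 0) at_top"
      by (rule filterlim_compose[OF tendsto_inverse_0])
    then show "((\<lambda>t. - inverse (real n * t ^ n)) \<longlongrightarrow> 0) at_top"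
      by (metis minus_zero tendsto_minus)
  qed (use a in auto)
  then show ?thesis by simp
qed

text \<open>Polar coordinates in which the sphere is parametrised by the unit ball through
  \<open>y \<mapsto> y / |y|\<close>, so that no surface measure is required. Substituting \<open>r = t |y|\<close> and then
  \<open>x = t y\<close> reduces the formula to \<open>\<integral>\<^sub>a\<^sup>\<infinity> t\<^sup>-\<^sup>n\<^sup>-\<^sup>1 dt = a\<^sup>-\<^sup>n / n\<close>.\<close>
lemma nn_integral_polar:
  fixes f :: "'a::euclidean_space \<Rightarrow> ennreal"
  assumes [measurable]: "f \<in> borel_measurable borel"
  shows "(\<integral>\<^sup>+ y \<in> ball 0 1. (\<integral>\<^sup>+ r \<in> {0<..}. f ((r / norm y) *\<^sub>R y) \<partial>lborel) \<partial>lborel)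
    = ennreal (inverse (real DIM('a))) * (\<integral>\<^sup>+ x. f x * ennreal (inverse (norm x ^ (DIM('a) - 1))) \<partial>lborel)"
proof -
  let ?n = "DIM('a)"
  have [measurable]: "ball (0::'a) 1 \<in> sets borel" by simp
  have AE0: "AE y in lborel. y \<noteq> (0::'a)" by (rule AE_lborel_singleton)
  have "(\<integral>\<^sup>+ y \<in> ball 0 1. (\<integral>\<^sup>+ r \<in> {0<..}. f ((r / norm y) *\<^sub>R y) \<partial>lborel) \<partial>lborel)
      = (\<integral>\<^sup>+ y. (\<integral>\<^sup>+ t. f (t *\<^sub>R y) * ennreal (norm y) * indicator {0<..} t * indicator (ball 0 1) y \<partial>lborel) \<partial>lborel)"
  proof (rule nn_integral_cong_AE, use AE0 in eventually_elim)
    case (elim y)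
    then have ny: "0 < norm y" by simp
    have "(\<integral>\<^sup>+ r \<in> {0<..}. f ((r / norm y) *\<^sub>R y) \<partial>lborel)
        = ennreal (norm y) * (\<integral>\<^sup>+ t. f (((0 + norm y * t) / norm y) *\<^sub>R y) * indicator {0<..} (0 + norm y * t) \<partial>lborel)"
      using ny by (subst nn_integral_real_affine[where c="norm y" and t=0]) auto
    also have "\<dots> = (\<integral>\<^sup>+ t. f (t *\<^sub>R y) * ennreal (norm y) * indicator {0<..} t \<partial>lborel)"
      using ny by (subst nn_integral_cmult[symmetric])
        (auto intro!: nn_integral_cong simp: zero_less_mult_iff mult_ac split: split_indicator)
    finally show ?case by (simp add: nn_integral_multc[symmetric])
  qed
  also have "\<dots> = (\<integral>\<^sup>+ t. (\<integral>\<^sup>+ y. f (t *\<^sub>R y) * ennreal (norm y) * indicator {0<..} t * indicator (ball 0 1) y \<partial>lborel) \<partial>lborel)"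
    by (rule lborel_pair.Fubini') measurable
  \<comment> \<open>On the right the indicator of positive \<open>t\<close> is absorbed:
    \<open>norm x < t\<close> already forces \<open>t\<close> to be positive.\<close>
  also have "\<dots> = (\<integral>\<^sup>+ t. (\<integral>\<^sup>+ x. f x * ennreal (norm x) * (ennreal (inverse (t ^ Suc ?n)) * (if norm x < t then 1 else 0)) \<partial>lborel) \<partial>lborel)"
  proof (rule nn_integral_cong)
    fix t :: real
    show "(\<integral>\<^sup>+ y. f (t *\<^sub>R y) * ennreal (norm y) * indicator {0<..} t * indicator (ball 0 1) y \<partial>lborel)
        = (\<integral>\<^sup>+ x. f x * ennreal (norm x) * (ennreal (inverse (t ^ Suc ?n)) * (if norm x < t then 1 else 0)) \<partial>lborel)"
    proof (cases "0 < t")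
      case True
      \<comment> \<open>The integrand rewritten in \<open>x = t y\<close>: the factor
        \<open>norm y\<close> becomes \<open>norm x / t\<close>, and membership in the unit ball
        becomes \<open>norm x < t\<close>.\<close>
      let ?h = "\<lambda>x::'a. f x * ennreal (norm x / t) * (if norm x < t then 1 else 0)"
      have "(\<integral>\<^sup>+ y. f (t *\<^sub>R y) * ennreal (norm y) * indicator {0<..} t * indicator (ball 0 1) y \<partial>lborel)
          = (\<integral>\<^sup>+ y. ?h (t *\<^sub>R y) \<partial>lborel)"
        using True by (intro nn_integral_cong) (auto split: split_indicator)
      also have "\<dots> = ennreal (inverse (t ^ ?n)) * (\<integral>\<^sup>+ x. ?h x \<partial>lborel)"
        using True by (intro nn_integral_lborel_scaleR) auto
      also have "\<dots> = (\<integral>\<^sup>+ x. ennreal (inverse (t ^ ?n)) * ?h x \<partial>lborel)"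
        by (rule nn_integral_cmult[symmetric]) simp
      also have "\<dots> = (\<integral>\<^sup>+ x. f x * ennreal (norm x) * (ennreal (inverse (t ^ Suc ?n)) * (if norm x < t then 1 else 0)) \<partial>lborel)"
      proof (rule nn_integral_cong)
        fix x :: 'a
        have eq: "ennreal (inverse (t ^ ?n)) * ennreal (norm x / t) = ennreal (norm x) * ennreal (inverse (t ^ Suc ?n))"
          using True by (simp add: ennreal_mult[symmetric] divide_inverse mult_ac)
        have "ennreal (inverse (t ^ ?n)) * ?h x
            = f x * (ennreal (inverse (t ^ ?n)) * ennreal (norm x / t)) * (if norm x < t then 1 else 0)"
          by (simp only: mult_ac)
        also have "\<dots> = f x * ennreal (norm x) * (ennreal (inverse (t ^ Suc ?n)) * (if norm x < t then 1 else 0))"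
          unfolding eq by (simp only: mult_ac)
        finally show "ennreal (inverse (t ^ ?n)) * ?h x
            = f x * ennreal (norm x) * (ennreal (inverse (t ^ Suc ?n)) * (if norm x < t then 1 else 0))" .
      qed
      finally show ?thesis .
    next
      case False
      then have "\<not> norm x < t" for x :: 'a using norm_ge_zero[of x] by linarith
      with False show ?thesis by simp
    qed
  qed
  also have "\<dots> = (\<integral>\<^sup>+ x. (\<integral>\<^sup>+ t. f x * ennreal (norm x) * (ennreal (inverse (t ^ Suc ?n)) * (if norm x < t then 1 else 0)) \<partial>lborel) \<partial>lborel)"
    by (rule lborel_pair.Fubini') measurable
  also have "\<dots> = (\<integral>\<^sup>+ x. ennreal (inverse (real ?n)) * (f x * ennreal (inverse (norm x ^ (?n - 1)))) \<partial>lborel)"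
  proof (rule nn_integral_cong_AE, use AE0 in eventually_elim)
    case (elim x)
    have "(\<integral>\<^sup>+ t. f x * ennreal (norm x) * (ennreal (inverse (t ^ Suc ?n)) * (if norm x < t then 1 else 0)) \<partial>lborel)
        = f x * ennreal (norm x) * (\<integral>\<^sup>+ t. ennreal (inverse (t ^ Suc ?n)) * (if norm x < t then 1 else 0) \<partial>lborel)"
      by (rule nn_integral_cmult) simp
    also have "(\<integral>\<^sup>+ t. ennreal (inverse (t ^ Suc ?n)) * (if norm x < t then 1 else 0) \<partial>lborel)
        = (\<integral>\<^sup>+ t. ennreal (inverse (t ^ Suc ?n)) * indicator {norm x..} t \<partial>lborel)"
    proof (rule nn_integral_cong_AE, use AE_lborel_singleton[of "norm x"] in eventually_elim)
      case (elim t)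
      then show ?case
        using norm_ge_zero[of x] by (auto split: split_indicator)
    qed
    also have "\<dots> = ennreal (inverse (real ?n * norm x ^ ?n))"
      using elim by (intro nn_integral_inverse_power_tail) auto
    also have "f x * ennreal (norm x) * \<dots> = ennreal (inverse (real ?n)) * (f x * ennreal (inverse (norm x ^ (?n - 1))))"
    proof -
      have "norm x ^ ?n = norm x * norm x ^ (?n - 1)" by (metis DIM_positive Suc_diff_1 power_Suc)
      then have "norm x * inverse (real ?n * norm x ^ ?n) = inverse (real ?n) * inverse (norm x ^ (?n - 1))"
        using elim by (simp add: field_simps)
      then have eq: "ennreal (norm x) * ennreal (inverse (real ?n * norm x ^ ?n)) = ennreal (inverse (real ?n)) * ennreal (inverse (norm x ^ (?n - 1)))"
        by (simp only: ennreal_mult[symmetric] norm_ge_zero zero_le_power inverse_nonnegative_iff_nonnegative of_nat_0_le_iff mult_nonneg_nonneg)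
      show ?thesis unfolding mult.assoc eq by (simp only: mult_ac)
    qed
    finally show ?case .
  qed
  also have "\<dots> = ennreal (inverse (real ?n)) * (\<integral>\<^sup>+ x. f x * ennreal (inverse (norm x ^ (?n - 1))) \<partial>lborel)"
    by (rule nn_integral_cmult) simp
  finally show ?thesis .
qed

subsection \<open>The normalising constant\<close>

text \<open>The exponent is controlled on the whole line, so that statements about it carry no side
  condition on \<open>r\<close>; the theorem instantiates the locale with a modified
  exponent.\<close>

locale radial_exponent =
  fixes p :: "real \<Rightarrow> real" and r1 r2 pm pM :: real
  assumes r1_pos: "0 < r1" and r1_less_r2: "r1 < r2"
    and p_borel [measurable]: "p \<in> borel_measurable borel"
    and pm_gt_1: "1 < pm" and p_ge: "pm \<le> p r" and p_le: "p r \<le> pM"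
begin

lemma p_gt_1: "1 < p r"
  using pm_gt_1 p_ge[of r] by linarith

lemma pM_gt_1: "1 < pM"
  using p_gt_1[of 0] p_le[of 0] by linarith

definition rho_integral :: "real \<Rightarrow> nat \<Rightarrow> real \<Rightarrow> ennreal" where
  "rho_integral \<omega> n lam = (\<integral>\<^sup>+ r \<in> {r1<..<r2}. ennreal (rho_star p \<omega> n lam r) \<partial>lborel)"

lemma rho_star_borel [measurable]: "rho_star p \<omega> n lam \<in> borel_measurable borel"
  unfolding rho_star_def by measurable

lemma rho_star_pos:
  assumes "0 < \<omega>" "0 < lam" "0 < r"
  shows "0 < rho_star p \<omega> n lam r"
proof -
  have "0 < lam / (p r * \<omega> * r ^ (n - 1))" using assms p_gt_1[of r] by auto
  then show ?thesis unfolding rho_star_def powr_gt_zero by (rule less_imp_neq[symmetric])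
qed

lemma rho_star_scale:
  assumes "0 < \<omega>" "0 < lam" "0 < s" "0 < r"
  shows "rho_star p \<omega> n (s * lam) r = s powr (1 / (p r - 1)) * rho_star p \<omega> n lam r"
  using assms p_gt_1[of r] by (simp add: rho_star_def powr_mult[symmetric])

text \<open>The exponent \<open>1 / (p r - 1)\<close> varies with \<open>r\<close> between two
  constants, and \<open>s powr _\<close> increases or decreases in it according to whether
  \<open>s\<close> exceeds 1; minimum and maximum cover both cases. This bounds the effect of
  replacing \<open>lam\<close> by \<open>s * lam\<close> uniformly in \<open>r\<close>.\<close>

lemma powr_exponent_between:
  assumes "0 < s"
  shows "min (s powr (1 / (pM - 1))) (s powr (1 / (pm - 1))) \<le> s powr (1 / (p r - 1))"
    and "s powr (1 / (p r - 1)) \<le> max (s powr (1 / (pM - 1))) (s powr (1 / (pm - 1)))"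
proof -
  have e: "1 / (pM - 1) \<le> 1 / (p r - 1)" "1 / (p r - 1) \<le> 1 / (pm - 1)"
    using pm_gt_1 p_ge[of r] p_le[of r] p_gt_1[of r] by (auto intro!: divide_left_mono)
  show "min (s powr (1 / (pM - 1))) (s powr (1 / (pm - 1))) \<le> s powr (1 / (p r - 1))"
    using e assms powr_mono[of _ _ s] powr_mono'[of _ _ s] by (cases "1 \<le> s") (auto simp: min_le_iff_disj)
  show "s powr (1 / (p r - 1)) \<le> max (s powr (1 / (pM - 1))) (s powr (1 / (pm - 1)))"
    using e assms powr_mono[of _ _ s] powr_mono'[of _ _ s] by (cases "1 \<le> s") (auto simp: le_max_iff_disj)
qed

lemma rho_integral_finite:
  assumes "0 < \<omega>" "0 < lam"
  shows "rho_integral \<omega> n lam < \<infinity>"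
proof -
  \<comment> \<open>The fraction bounds the base of \<open>rho_star\<close>, as
    \<open>p r > 1\<close> and \<open>r > r1\<close>; the maximum with 1 makes powers of
    \<open>B\<close> increase with the exponent.\<close>
  define B where "B = max 1 (lam / (\<omega> * r1 ^ (n - 1)))"
  have "rho_star p \<omega> n lam r \<le> B powr (1 / (pm - 1))" if r: "r \<in> {r1<..<r2}" for r
  proof -
    have pos: "0 < r" "0 < r ^ (n - 1)" "0 < r1 ^ (n - 1)" using r r1_pos by auto
    have "1 * (\<omega> * r1 ^ (n - 1)) \<le> p r * (\<omega> * r ^ (n - 1))"
      using r pos assms r1_pos p_gt_1[of r] by (intro mult_mono power_mono) auto
    then have "lam / (p r * \<omega> * r ^ (n - 1)) \<le> lam / (\<omega> * r1 ^ (n - 1))"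
      using pos assms p_gt_1[of r] by (intro divide_left_mono) (auto simp: mult_ac)
    then have "lam / (p r * \<omega> * r ^ (n - 1)) \<le> B" by (simp add: B_def)
    then have "rho_star p \<omega> n lam r \<le> B powr (1 / (p r - 1))"
      unfolding rho_star_def using pos assms p_gt_1[of r] by (intro powr_mono2) auto
    also have "\<dots> \<le> B powr (1 / (pm - 1))"
      using pm_gt_1 p_ge[of r] by (intro powr_mono divide_left_mono) (auto simp: B_def)
    finally show ?thesis .
  qed
  then have "rho_integral \<omega> n lam \<le> (\<integral>\<^sup>+ r \<in> {r1<..<r2}. ennreal (B powr (1 / (pm - 1))) \<partial>lborel)"
    unfolding rho_integral_def by (intro nn_integral_mono) (auto split: split_indicator intro: ennreal_leI)
  also have "\<dots> < \<infinity>"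
    using r1_less_r2 by (simp add: nn_integral_cmult_indicator ennreal_mult_less_top)
  finally show ?thesis .
qed

lemma rho_integral_pos:
  assumes "0 < \<omega>" "0 < lam"
  shows "0 < rho_integral \<omega> n lam"
proof (rule ccontr)
  assume "\<not> 0 < rho_integral \<omega> n lam"
  then have "AE r in lborel. ennreal (rho_star p \<omega> n lam r) * indicator {r1<..<r2} r = 0"
    unfolding rho_integral_def by (subst (asm) zero_less_iff_neq_zero) (simp add: nn_integral_0_iff_AE)
  then have "AE r in lborel. r \<notin> {r1<..<r2}"
  proof eventually_elim
    case (elim r)
    show ?case
    proof
      assume r: "r \<in> {r1<..<r2}"
      then have "0 < rho_star p \<omega> n lam r" using assms r1_pos by (intro rho_star_pos) auto
      with elim r show False by simp
    qed
  qed
  then have "emeasure lborel {r1<..<r2} = 0"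
    by (subst (asm) AE_iff_measurable[OF _ refl]) (auto simp: greaterThanLessThan_def greaterThan_def lessThan_def Int_def)
  then show False using r1_less_r2 by simp
qed

lemma rho_integral_scale:
  assumes "0 < \<omega>" "0 < lam" "0 < s"
  shows "ennreal (min (s powr (1 / (pM - 1))) (s powr (1 / (pm - 1)))) * rho_integral \<omega> n lam \<le> rho_integral \<omega> n (s * lam)"
    and "rho_integral \<omega> n (s * lam) \<le> ennreal (max (s powr (1 / (pM - 1))) (s powr (1 / (pm - 1)))) * rho_integral \<omega> n lam"
proof -
  let ?m = "min (s powr (1 / (pM - 1))) (s powr (1 / (pm - 1)))"
  let ?M = "max (s powr (1 / (pM - 1))) (s powr (1 / (pm - 1)))"
  have *: "?m * rho_star p \<omega> n lam r \<le> rho_star p \<omega> n (s * lam) r \<and> rho_star p \<omega> n (s * lam) r \<le> ?M * rho_star p \<omega> n lam r"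
    if "r \<in> {r1<..<r2}" for r
    using powr_exponent_between[OF assms(3), of r] rho_star_pos[OF assms(1,2), of r n] that r1_pos
    by (subst (1 2) rho_star_scale) (use assms in \<open>auto intro!: mult_right_mono\<close>)
  have c: "ennreal k * rho_integral \<omega> n lam = (\<integral>\<^sup>+ r \<in> {r1<..<r2}. ennreal (k * rho_star p \<omega> n lam r) \<partial>lborel)"
    if "0 \<le> k" for k
    unfolding rho_integral_def
    by (subst nn_integral_cmult[symmetric]) (auto simp: ennreal_mult' that mult.assoc)
  show "ennreal ?m * rho_integral \<omega> n lam \<le> rho_integral \<omega> n (s * lam)"
    using * by (subst c) (auto simp: rho_integral_def intro!: nn_integral_mono ennreal_leI split: split_indicator)
  show "rho_integral \<omega> n (s * lam) \<le> ennreal ?M * rho_integral \<omega> n lam"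
    using * by (subst c) (auto simp: rho_integral_def le_max_iff_disj intro!: nn_integral_mono ennreal_leI split: split_indicator)
qed

text \<open>Everything comes from \<open>lo s * I lam \<le> I (s * lam) \<le> hi s * I lam\<close>:
  continuity by squeezing as \<open>s\<close> tends to 1, values on both sides of 1 by power growth,
  and strict increase because \<open>lo s > 1\<close> for \<open>s > 1\<close>.\<close>

lemma ex1_rho_integral_eq_1:
  assumes \<omega>: "0 < \<omega>"
  shows "\<exists>!lam. 0 < lam \<and> rho_integral \<omega> n lam = 1"
proof -
  define I where "I lam = enn2real (rho_integral \<omega> n lam)" for lam
  have I: "rho_integral \<omega> n lam = ennreal (I lam)" "0 < I lam" if "0 < lam" for lam
    using rho_integral_finite[OF \<omega> that, of n] rho_integral_pos[OF \<omega> that, of n]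
    by (auto simp: I_def enn2real_positive_iff)
  define lo where "lo s = min (s powr (1 / (pM - 1))) (s powr (1 / (pm - 1)))" for s
  define hi where "hi s = max (s powr (1 / (pM - 1))) (s powr (1 / (pm - 1)))" for s
  have scale: "lo s * I lam \<le> I (s * lam)" "I (s * lam) \<le> hi s * I lam" if "0 < lam" "0 < s" for s lam
  proof -
    have nn: "0 \<le> lo s" "0 \<le> hi s" by (auto simp: lo_def hi_def le_max_iff_disj)
    have pos: "0 < s * lam" using that by simp
    show "lo s * I lam \<le> I (s * lam)" "I (s * lam) \<le> hi s * I lam"
      using rho_integral_scale[OF \<omega> that, of n] I[OF that(1)] I[OF pos] nn
      unfolding lo_def[symmetric] hi_def[symmetric]
      by (auto simp: ennreal_mult[symmetric] less_imp_le)
  qed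
  have cont: "continuous_on {a..b} I" if "0 < a" for a b
  proof (rule continuous_on_subset)
    show "continuous_on {0<..} I"
      unfolding continuous_on_def
    proof
      fix x :: real assume "x \<in> {0<..}"
      then have x: "0 < x" by simp
      have lim: "((\<lambda>y. lo (y / x) * I x) \<longlongrightarrow> I x) (at x within {0<..})"
        "((\<lambda>y. hi (y / x) * I x) \<longlongrightarrow> I x) (at x within {0<..})"
        unfolding lo_def hi_def using x by (auto intro!: tendsto_eq_intros)
      have ev: "\<forall>\<^sub>F y in at x within {0<..}. lo (y / x) * I x \<le> I y \<and> I y \<le> hi (y / x) * I x"
        unfolding eventually_at_filter
        using scale[OF x, of "y / x" for y] x by (intro always_eventually) auto
      show "(I \<longlongrightarrow> I x) (at x within {0<..})"
        by (rule tendsto_sandwich[OF _ _ lim]; use ev in eventually_elim) auto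
    qed
  qed (use that in auto)
  \<comment> \<open>The smaller of the two exponents: it realises \<open>hi\<close> for
    \<open>s \<le> 1\<close> and \<open>lo\<close> for \<open>s \<ge> 1\<close>, the ranges in which
    these bounds are used below.\<close>
  define \<alpha> where "\<alpha> = 1 / (pM - 1)"
  have \<alpha>: "0 < \<alpha>" "\<alpha> \<le> 1 / (pm - 1)"
    using pM_gt_1 pm_gt_1 p_ge[of 0] p_le[of 0] by (auto simp: \<alpha>_def intro!: divide_left_mono)
  have hi_eq: "hi s = s powr \<alpha>" if "0 < s" "s \<le> 1" for s
    using powr_mono'[OF \<alpha>(2), of s] that by (simp add: hi_def \<alpha>_def[symmetric] max_def)
  have lo_eq: "lo s = s powr \<alpha>" if "1 \<le> s" for s
    using powr_mono[OF \<alpha>(2), of s] that by (simp add: lo_def \<alpha>_def[symmetric] min_def)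
  define c where "c = I 1"
  have c: "0 < c" using I(2)[of 1] by (simp add: c_def)
  \<comment> \<open>\<open>k\<close> solves \<open>k powr \<alpha> * I 1 = 1\<close>. Since it may
    lie on either side of 1, the bracket for the intermediate value theorem is
    \<open>min 1 k\<close> and \<open>max 1 k\<close>.\<close>
  define k where "k = (1 / c) powr (1 / \<alpha>)"
  have k: "0 < k" "k powr \<alpha> = 1 / c"
    using c \<alpha> by (auto simp: k_def powr_powr)
  have "I (min 1 k) \<le> hi (min 1 k) * c" using scale(2)[of 1 "min 1 k"] k by (simp add: c_def)
  also have "\<dots> = (min 1 k) powr \<alpha> * c" using k by (subst hi_eq) auto
  also have "\<dots> \<le> k powr \<alpha> * c" using k c \<alpha> by (intro mult_right_mono powr_mono2) auto
  finally have le: "I (min 1 k) \<le> 1" using k c by simp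
  have "1 \<le> k powr \<alpha> * c" using k c by simp
  also have "\<dots> \<le> (max 1 k) powr \<alpha> * c" using k c \<alpha> by (intro mult_right_mono powr_mono2) auto
  also have "\<dots> = lo (max 1 k) * c" by (subst lo_eq) auto
  also have "\<dots> \<le> I (max 1 k)" using scale(1)[of 1 "max 1 k"] k by (simp add: c_def)
  finally have ge: "1 \<le> I (max 1 k)" .
  have "\<exists>x. min 1 k \<le> x \<and> x \<le> max 1 k \<and> I x = 1"
    using k by (intro IVT' le ge cont) auto
  then obtain lam where lam: "min 1 k \<le> lam" "I lam = 1" by auto
  have lam0: "0 < lam" using lam k by (auto simp: min_def split: if_splits)
  have strict: "I x < I y" if "0 < x" "x < y" for x y
  proof -
    have s: "1 < y / x" using that by simp
    have "1 * I x < (y / x) powr \<alpha> * I x"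
      using s \<alpha> I(2)[OF that(1)] by (intro mult_strict_right_mono) (auto intro: gr_one_powr)
    also have "\<dots> = lo (y / x) * I x" using s by (subst lo_eq) auto
    also have "\<dots> \<le> I y" using scale(1)[of x "y / x"] that by simp
    finally show ?thesis by simp
  qed
  have eq: "rho_integral \<omega> n x = 1 \<longleftrightarrow> I x = 1" if "0 < x" for x
    using I(1)[OF that] I(2)[OF that] by (simp add: ennreal_eq_1)
  show ?thesis
  proof (intro ex1I conjI)
    show "0 < lam" "rho_integral \<omega> n lam = 1" using lam lam0 eq by auto
    fix y assume "0 < y \<and> rho_integral \<omega> n y = 1"
    then show "y = lam" using eq[of y] strict[of y lam] strict[of lam y] lam lam0
      by (cases y lam rule: linorder_cases) auto
  qed
qed

end

subsection \<open>Tangent inequality and integrals over the annulus\<close>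

text \<open>Strict convexity through the mean value theorem: the chord slope equals the derivative
  at a point strictly between \<open>s\<close> and \<open>t\<close>, and the derivative is strictly
  increasing. The case \<open>t = 0\<close> is computed directly, as \<open>powr\<close> is
  differentiated at positive points.\<close>

lemma powr_gt_tangent:
  fixes s t q :: real
  assumes q: "1 < q" and s: "0 < s" and t: "0 \<le> t" "t \<noteq> s"
  shows "s powr q + q * s powr (q - 1) * (t - s) < t powr q"
proof -
  have MVT: "\<exists>z. u < z \<and> z < v \<and> v powr q - u powr q = (v - u) * (q * z powr (q - 1))" if "0 < u" "u < v" for u v
    using that by (intro MVT2) (auto intro!: derivative_eq_intros)
  consider "t = 0" | "0 < t" "t < s" | "s < t" using t by linarith
  then show ?thesis
  proof cases
    case 1
    have "s powr q = s powr (q - 1) * s" using powr_add[of s "q - 1" 1] s by simp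
    then have "s powr q + q * s powr (q - 1) * (t - s) = - ((q - 1) * s powr q)" using 1 by (simp add: algebra_simps)
    also have "\<dots> < 0" using q s by simp
    finally show ?thesis using 1 by simp
  next
    case 2
    then obtain z where z: "t < z" "z < s" "s powr q - t powr q = (s - t) * (q * z powr (q - 1))" using MVT by blast
    have "(s - t) * (q * z powr (q - 1)) < (s - t) * (q * s powr (q - 1))"
      using z 2 q by (intro mult_strict_left_mono powr_less_mono2) auto
    then show ?thesis using z(3) by (simp add: algebra_simps)
  next
    case 3
    then obtain z where z: "s < z" "z < t" "t powr q - s powr q = (t - s) * (q * z powr (q - 1))" using MVT s by blast
    have "(t - s) * (q * s powr (q - 1)) < (t - s) * (q * z powr (q - 1))"
      using z 3 s q by (intro mult_strict_left_mono powr_less_mono2) auto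
    then show ?thesis using z(3) by (simp add: algebra_simps)
  qed
qed

lemma epow_ennreal: "0 \<le> t \<Longrightarrow> epow (ennreal t) q = ennreal (t powr q)"
  by (simp add: epow_def)

lemma epow_borel [measurable]:
  assumes [measurable]: "f \<in> borel_measurable M" "q \<in> borel_measurable M"
  shows "(\<lambda>x. epow (f x) (q x)) \<in> borel_measurable M"
  unfolding epow_def by measurable

text \<open>The negative term of the tangent is moved across, leaving only sums; at
  \<open>x = top\<close> the right-hand side is infinite.\<close>

lemma epow_tangent_le:
  assumes q: "1 < q" and s: "0 < s"
  shows "ennreal (s powr q) + ennreal (q * s powr (q - 1)) * x
    \<le> epow x q + ennreal (q * s powr (q - 1)) * ennreal s"
proof (cases x)
  case (real t)
  have "s powr q + q * s powr (q - 1) * t \<le> t powr q + q * s powr (q - 1) * s"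
    using powr_gt_tangent[OF q s, of t] real by (cases "t = s") (auto simp: algebra_simps)
  then show ?thesis
    using real q s by (simp add: epow_ennreal ennreal_mult[symmetric] ennreal_plus[symmetric] del: ennreal_plus)
qed (simp add: epow_def)

text \<open>At \<open>x = top\<close> both sides are infinite and equality carries no information,
  hence the finiteness condition on \<open>epow x q\<close>.\<close>

lemma epow_tangent_eqD:
  assumes q: "1 < q" and s: "0 < s" and x: "epow x q \<noteq> top"
    and eq: "ennreal (s powr q) + ennreal (q * s powr (q - 1)) * x
      = epow x q + ennreal (q * s powr (q - 1)) * ennreal s"
  shows "x = ennreal s"
proof (cases x)
  case (real t)
  have "s powr q + q * s powr (q - 1) * t = t powr q + q * s powr (q - 1) * s"
    using real q s eq by (simp add: epow_ennreal ennreal_mult[symmetric] ennreal_plus[symmetric] del: ennreal_plus)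
  then show ?thesis
    using powr_gt_tangent[OF q s, of t] real by (cases "t = s") (auto simp: algebra_simps)
qed (use x in \<open>simp add: epow_def\<close>)

lemma AE_eq_of_nn_integral_le:
  fixes f g :: "'a \<Rightarrow> ennreal"
  assumes [measurable]: "f \<in> borel_measurable M" "g \<in> borel_measurable M"
    and le: "\<And>x. f x \<le> g x" and ge: "(\<integral>\<^sup>+ x. g x \<partial>M) \<le> (\<integral>\<^sup>+ x. f x \<partial>M)"
    and fin: "(\<integral>\<^sup>+ x. f x \<partial>M) \<noteq> \<infinity>"
  shows "AE x in M. f x = g x"
proof -
  have "(\<integral>\<^sup>+ x. g x - f x \<partial>M) = (\<integral>\<^sup>+ x. g x \<partial>M) - (\<integral>\<^sup>+ x. f x \<partial>M)"
    using le fin by (intro nn_integral_diff) auto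
  also have "\<dots> = 0"
    using ge fin le_less_trans[OF ge, of top] by (intro diff_eq_0_ennreal) (auto simp: top.not_eq_extremum)
  finally have "AE x in M. g x - f x = 0" by (simp add: nn_integral_0_iff_AE)
  moreover have "AE x in M. f x \<noteq> \<infinity>" using fin by (intro nn_integral_PInf_AE) auto
  ultimately show ?thesis
  proof eventually_elim
    case (elim x)
    then have "g x \<le> f x" by (simp add: diff_eq_0_iff_ennreal)
    with le[of x] show ?case by simp
  qed
qed

section \<open>Weighted integrals over the annulus\<close>

lemma annulus_borel [measurable]: "annulus r1 r2 \<in> sets (borel :: 'a::euclidean_space measure)"
  unfolding annulus_def by measurable

lemma sphere_area_pos: "0 < sphere_area TYPE('a::euclidean_space)"
proof -
  have "0 < measure lborel (ball (0::'a) 1)" by (simp add: content_ball_pos)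
  then show ?thesis by (simp add: sphere_area_def)
qed

lemma ennreal_sphere_area:
  "ennreal (sphere_area TYPE('a::euclidean_space)) = ennreal (real DIM('a)) * emeasure lborel (ball (0::'a) 1)"
  using emeasure_lborel_ball_finite[of "0::'a" 1]
  by (simp add: sphere_area_def ennreal_mult emeasure_eq_ennreal_measure top.not_eq_extremum)

text \<open>The weight cancels the radial Jacobian, leaving a plain integral along each ray, which
  is the quantity that admissibility bounds. The formula is \<open>nn_integral_polar\<close> for
  \<open>f\<close> cut off outside the annulus.\<close>

lemma nn_integral_annulus_polar:
  fixes f :: "'a::euclidean_space \<Rightarrow> ennreal"
  assumes [measurable]: "f \<in> borel_measurable borel" and r1: "0 < r1"
  shows "(\<integral>\<^sup>+ x \<in> annulus r1 r2. f x * ennreal (inverse (norm x ^ (DIM('a) - 1))) \<partial>lborel)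
    = ennreal (real DIM('a)) * (\<integral>\<^sup>+ y \<in> ball 0 1. (\<integral>\<^sup>+ r \<in> {r1<..<r2}. f (r *\<^sub>R sgn y) \<partial>lborel) \<partial>lborel)"
proof -
  let ?f = "\<lambda>x. f x * indicator (annulus r1 r2) x"
  have "(\<integral>\<^sup>+ y \<in> ball 0 1. (\<integral>\<^sup>+ r \<in> {r1<..<r2}. f (r *\<^sub>R sgn y) \<partial>lborel) \<partial>lborel)
    = (\<integral>\<^sup>+ y \<in> ball 0 1. (\<integral>\<^sup>+ r \<in> {0<..}. ?f ((r / norm y) *\<^sub>R y) \<partial>lborel) \<partial>lborel)"
  proof (rule nn_integral_cong_AE, use AE_lborel_singleton[of "0::'a"] in eventually_elim)
    case (elim y)
    have "(\<integral>\<^sup>+ r \<in> {r1<..<r2}. f (r *\<^sub>R sgn y) \<partial>lborel) = (\<integral>\<^sup>+ r \<in> {0<..}. ?f ((r / norm y) *\<^sub>R y) \<partial>lborel)"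
    proof (rule nn_integral_cong)
      fix r :: real
      have "(r / norm y) *\<^sub>R y \<in> annulus r1 r2 \<longleftrightarrow> r \<in> {r1<..<r2}" if "0 < r"
        using that elim by (simp add: annulus_def)
      then show "f (r *\<^sub>R sgn y) * indicator {r1<..<r2} r = ?f ((r / norm y) *\<^sub>R y) * indicator {0<..} r"
        using r1 by (cases "0 < r") (auto simp: sgn_div_norm divide_inverse split: split_indicator)
    qed
    then show ?case by simp
  qed
  also have "\<dots> = ennreal (inverse (real DIM('a))) * (\<integral>\<^sup>+ x. ?f x * ennreal (inverse (norm x ^ (DIM('a) - 1))) \<partial>lborel)"
    by (rule nn_integral_polar) simp
  finally show ?thesis
    by (simp add: mult.assoc[symmetric] ennreal_mult[symmetric]) (simp add: mult_ac)
qed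

lemma nn_integral_annulus_radial:
  fixes f :: "real \<Rightarrow> ennreal"
  assumes [measurable]: "f \<in> borel_measurable borel" and r1: "0 < r1"
  shows "(\<integral>\<^sup>+ x \<in> annulus r1 r2. f (norm x) * ennreal (inverse (norm x ^ (DIM('a) - 1))) \<partial>(lborel :: 'a::euclidean_space measure))
    = ennreal (sphere_area TYPE('a)) * (\<integral>\<^sup>+ r \<in> {r1<..<r2}. f r \<partial>lborel)"
proof -
  have "(\<integral>\<^sup>+ y \<in> ball (0::'a) 1. (\<integral>\<^sup>+ r \<in> {r1<..<r2}. f (norm (r *\<^sub>R sgn y)) \<partial>lborel) \<partial>lborel)
    = (\<integral>\<^sup>+ y \<in> ball (0::'a) 1. (\<integral>\<^sup>+ r \<in> {r1<..<r2}. f r \<partial>lborel) \<partial>lborel)"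
  proof (rule nn_integral_cong_AE, use AE_lborel_singleton[of "0::'a"] in eventually_elim)
    case (elim y)
    have "(\<integral>\<^sup>+ r \<in> {r1<..<r2}. f (norm (r *\<^sub>R sgn y)) \<partial>lborel) = (\<integral>\<^sup>+ r \<in> {r1<..<r2}. f r \<partial>lborel)"
      using elim r1 by (intro nn_integral_cong) (auto simp: norm_sgn split: split_indicator)
    then show ?case by simp
  qed
  also have "\<dots> = (\<integral>\<^sup>+ r \<in> {r1<..<r2}. f r \<partial>lborel) * emeasure lborel (ball (0::'a) 1)"
    by (simp add: nn_integral_cmult_indicator)
  finally show ?thesis
    by (subst nn_integral_annulus_polar) (use r1 in \<open>simp_all add: ennreal_sphere_area mult_ac\<close>)
qed

lemma sphere_area_le_nn_integral_admissible:
  fixes \<rho> :: "'a::euclidean_space \<Rightarrow> ennreal"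
  assumes \<rho>: "admissible (joining_curves r1 r2) \<rho>" and r: "0 < r1" "r1 < r2"
  shows "ennreal (sphere_area TYPE('a))
    \<le> (\<integral>\<^sup>+ x \<in> annulus r1 r2. \<rho> x * ennreal (inverse (norm x ^ (DIM('a) - 1))) \<partial>lborel)"
proof -
  have [measurable]: "\<rho> \<in> borel_measurable borel" using \<rho> by (simp add: admissible_def)
  have "emeasure lborel (ball (0::'a) 1) = (\<integral>\<^sup>+ y. indicator (ball (0::'a) 1) y \<partial>lborel)" by simp
  also have "\<dots> \<le> (\<integral>\<^sup>+ y \<in> ball 0 1. (\<integral>\<^sup>+ r \<in> {r1<..<r2}. \<rho> (r *\<^sub>R sgn y) \<partial>lborel) \<partial>lborel)"
  proof (rule nn_integral_mono_AE, use AE_lborel_singleton[of "0::'a"] in eventually_elim)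
    case (elim y)
    then have u: "norm (sgn y) = 1" by (simp add: norm_sgn)
    let ?g = "\<lambda>t. (r1 + (r2 - r1) * t) *\<^sub>R sgn y"
    have "1 \<le> line_integral ?g \<rho>"
      using \<rho> radial_segment_in_joining_curves[OF u r] rectifiable_curve_radial_segment[OF u, of "r2 - r1" r1] r
      by (simp add: admissible_def)
    also have "\<dots> = (\<integral>\<^sup>+ r \<in> {r1<..<r2}. \<rho> (r *\<^sub>R sgn y) \<partial>lborel)"
      using r by (intro line_integral_radial_segment u) auto
    finally show ?case by (auto split: split_indicator)
  qed
  finally have "emeasure lborel (ball (0::'a) 1) \<le> (\<integral>\<^sup>+ y \<in> ball 0 1. (\<integral>\<^sup>+ r \<in> {r1<..<r2}. \<rho> (r *\<^sub>R sgn y) \<partial>lborel) \<partial>lborel)" .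
  then show ?thesis
    by (subst nn_integral_annulus_polar) (use r in \<open>auto simp: ennreal_sphere_area intro: mult_left_mono\<close>)
qed

subsection \<open>Extremality\<close>

context radial_exponent
begin

definition rho_density :: "real \<Rightarrow> 'a::euclidean_space \<Rightarrow> ennreal" where
  "rho_density lam x = (if x \<in> annulus r1 r2
     then ennreal (rho_star p (sphere_area TYPE('a)) DIM('a) lam (norm x)) else 0)"

definition energy :: "('a::euclidean_space \<Rightarrow> ennreal) \<Rightarrow> ennreal" where
  "energy \<rho> = (\<integral>\<^sup>+ x \<in> annulus r1 r2. epow (\<rho> x) (p (norm x)) \<partial>lborel)"

lemma rho_density_borel [measurable]: "rho_density lam \<in> borel_measurable borel"
  unfolding rho_density_def by measurable

lemma admissible_rho_density:
  assumes norm1: "rho_integral (sphere_area TYPE('a::euclidean_space)) DIM('a) lam = 1"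
  shows "admissible (joining_curves r1 r2) (rho_density lam :: 'a \<Rightarrow> ennreal)"
  unfolding admissible_def
proof (intro conjI ballI impI)
  fix g :: "real \<Rightarrow> 'a" assume g: "g \<in> joining_curves r1 r2" "rectifiable_curve g"
  \<comment> \<open>Putting the cut-off into the radial profile makes its composition with the norm
    exactly \<open>rho_density\<close>, including the value 0 at the end points of the
    curve.\<close>
  let ?f = "\<lambda>r. ennreal (rho_star p (sphere_area TYPE('a)) DIM('a) lam r) * indicator {r1<..<r2} r"
  have "1 = (\<integral>\<^sup>+ r \<in> {r1<..<r2}. ?f r \<partial>lborel)"
    unfolding norm1[symmetric] rho_integral_def by (intro nn_integral_cong) (auto split: split_indicator)
  also have "\<dots> \<le> line_integral g (\<lambda>x. ?f (norm x))"
    using g r1_less_r2 by (intro line_integral_norm_ge) auto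
  also have "(\<lambda>x::'a. ?f (norm x)) = rho_density lam"
    by (auto simp: fun_eq_iff rho_density_def annulus_def)
  finally show "1 \<le> line_integral g (rho_density lam)" .
qed simp

lemma rho_star_powr:
  "rho_star p \<omega> n lam r powr p r = (lam / (p r * \<omega> * r ^ (n - 1))) powr (p r / (p r - 1))"
  by (simp add: rho_star_def powr_powr)

lemma p_mult_rho_star_powr:
  assumes \<omega>: "0 < \<omega>" and lam: "0 < lam" and "0 < r"
  shows "p r * rho_star p \<omega> n lam r powr (p r - 1) = lam / \<omega> * inverse (r ^ (n - 1))"
proof -
  define b where "b = lam / (p r * \<omega> * r ^ (n - 1))"
  have "0 \<le> b" using \<omega> lam \<open>0 < r\<close> p_gt_1[of r] by (auto simp: b_def)
  then have "rho_star p \<omega> n lam r powr (p r - 1) = b"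
    using p_gt_1[of r] by (simp add: rho_star_def b_def[symmetric] powr_powr del: One_nat_def)
  then have "rho_star p \<omega> n lam r powr (p r - 1) = lam / (p r * \<omega> * r ^ (n - 1))"
    by (simp add: b_def)
  then show ?thesis using p_gt_1[of r] by (simp add: field_simps)
qed

text \<open>\<open>w\<close> has two faces: by \<open>w_eq\<close> it is the slope of the tangent at
  \<open>\<rho>s\<close>, and as a multiple of a power of the norm it can be integrated in polar
  coordinates against any density.\<close>

context
  fixes lam :: real and \<rho>s :: "'a::euclidean_space \<Rightarrow> ennreal"
    and w :: "'a \<Rightarrow> ennreal"
  assumes lam: "0 < lam" and norm1: "rho_integral (sphere_area TYPE('a)) DIM('a) lam = 1"
  defines "\<rho>s \<equiv> rho_density lam"
    and "w \<equiv> \<lambda>x. ennreal (lam / sphere_area TYPE('a) * inverse (norm x ^ (DIM('a) - 1)))"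
begin

lemma rho_star_norm_pos:
  "x \<in> annulus r1 r2 \<Longrightarrow> 0 < rho_star p (sphere_area TYPE('a)) DIM('a) lam (norm (x::'a))"
  using r1_pos by (intro rho_star_pos sphere_area_pos lam) (auto simp: annulus_def)

lemma w_eq:
  assumes "x \<in> annulus r1 r2"
  shows "w x = ennreal (p (norm x) * rho_star p (sphere_area TYPE('a)) DIM('a) lam (norm x) powr (p (norm x) - 1))"
  using assms r1_pos by (subst p_mult_rho_star_powr[OF sphere_area_pos lam]) (auto simp: w_def annulus_def)

lemma w_borel [measurable]: "w \<in> borel_measurable borel"
  unfolding w_def by measurable

lemma weighted_integral_eq:
  assumes [measurable]: "\<rho> \<in> borel_measurable borel"
  shows "(\<integral>\<^sup>+ x \<in> annulus r1 r2. w x * \<rho> x \<partial>lborel) = ennreal (lam / sphere_area TYPE('a)) *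
    (\<integral>\<^sup>+ x \<in> annulus r1 r2. \<rho> x * ennreal (inverse (norm x ^ (DIM('a) - 1))) \<partial>lborel)"
proof -
  have "w x = ennreal (lam / sphere_area TYPE('a)) * ennreal (inverse (norm x ^ (DIM('a) - 1)))" for x
    unfolding w_def using lam sphere_area_pos[where 'a='a] by (intro ennreal_mult) auto
  then show ?thesis by (subst nn_integral_cmult[symmetric]) (auto simp: mult_ac)
qed

lemma lam_le_weighted_integral:
  assumes "admissible (joining_curves r1 r2) \<rho>"
  shows "ennreal lam \<le> (\<integral>\<^sup>+ x \<in> annulus r1 r2. w x * \<rho> x \<partial>lborel)"
proof -
  have "\<rho> \<in> borel_measurable borel" using assms by (simp add: admissible_def)
  have "ennreal lam = ennreal (lam / sphere_area TYPE('a)) * ennreal (sphere_area TYPE('a))"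
    using lam sphere_area_pos[where 'a='a] by (simp add: ennreal_mult[symmetric])
  also have "\<dots> \<le> (\<integral>\<^sup>+ x \<in> annulus r1 r2. w x * \<rho> x \<partial>lborel)"
    unfolding weighted_integral_eq[OF \<open>\<rho> \<in> borel_measurable borel\<close>]
    using sphere_area_le_nn_integral_admissible[OF assms r1_pos r1_less_r2] by (intro mult_left_mono) auto
  finally show ?thesis .
qed

text \<open>Equality for \<open>\<rho>s\<close>, against the lower bound
  \<open>lam_le_weighted_integral\<close> for all admissible densities, is where the normalisation
  of \<open>lam\<close> enters the comparison of energies.\<close>

lemma weighted_integral_rho_density: "(\<integral>\<^sup>+ x \<in> annulus r1 r2. w x * \<rho>s x \<partial>lborel) = ennreal lam"
proof -
  let ?f = "\<lambda>r. ennreal (rho_star p (sphere_area TYPE('a)) DIM('a) lam r)"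
  have "(\<integral>\<^sup>+ x \<in> annulus r1 r2. w x * \<rho>s x \<partial>lborel) = ennreal (lam / sphere_area TYPE('a)) *
    (\<integral>\<^sup>+ x \<in> annulus r1 r2. \<rho>s x * ennreal (inverse (norm x ^ (DIM('a) - 1))) \<partial>lborel)"
    by (rule weighted_integral_eq) (simp add: \<rho>s_def)
  also have "(\<integral>\<^sup>+ x \<in> annulus r1 r2. \<rho>s x * ennreal (inverse (norm x ^ (DIM('a) - 1))) \<partial>lborel)
    = (\<integral>\<^sup>+ x \<in> annulus r1 r2. ?f (norm x) * ennreal (inverse (norm x ^ (DIM('a) - 1))) \<partial>(lborel :: 'a measure))"
    by (intro nn_integral_cong) (auto simp: \<rho>s_def rho_density_def split: split_indicator)
  also have "\<dots> = ennreal (sphere_area TYPE('a)) * 1"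
    using norm1 r1_pos by (subst nn_integral_annulus_radial) (auto simp: rho_integral_def)
  finally show ?thesis
    using lam sphere_area_pos[where 'a='a] by (simp add: ennreal_mult[symmetric])
qed

lemma epow_rho_density:
  assumes "x \<in> annulus r1 r2"
  shows "epow (\<rho>s x) (p (norm x)) = ennreal (rho_star p (sphere_area TYPE('a)) DIM('a) lam (norm x) powr p (norm x))"
  using assms rho_star_norm_pos[OF assms] by (simp add: \<rho>s_def rho_density_def epow_ennreal)

lemma energy_rho_density:
  "energy \<rho>s = ennreal (sphere_area TYPE('a)) * (\<integral>\<^sup>+ r \<in> {r1<..<r2}.
     ennreal ((lam / (p r * sphere_area TYPE('a) * r ^ (DIM('a) - 1))) powr (p r / (p r - 1)) * r ^ (DIM('a) - 1)) \<partial>lborel)"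
proof -
  \<comment> \<open>The Jacobian is attached to the profile and divided out again, to match the
    weighted form of \<open>nn_integral_annulus_radial\<close>.\<close>
  let ?f = "\<lambda>r. ennreal ((lam / (p r * sphere_area TYPE('a) * r ^ (DIM('a) - 1))) powr (p r / (p r - 1)) * r ^ (DIM('a) - 1))"
  have "energy \<rho>s = (\<integral>\<^sup>+ x \<in> annulus r1 r2. ?f (norm x) * ennreal (inverse (norm x ^ (DIM('a) - 1))) \<partial>(lborel :: 'a measure))"
    unfolding energy_def
  proof (rule nn_integral_cong)
    fix x :: 'a
    show "epow (\<rho>s x) (p (norm x)) * indicator (annulus r1 r2) x
      = ?f (norm x) * ennreal (inverse (norm x ^ (DIM('a) - 1))) * indicator (annulus r1 r2) x"
    proof (cases "x \<in> annulus r1 r2")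
      case True
      have cancel: "ennreal (u * d) * ennreal (inverse d) = ennreal u" if "0 < d" "0 \<le> u" for u d :: real
        using that by (simp add: ennreal_mult[symmetric])
      have "0 < norm x ^ (DIM('a) - 1)" using True r1_pos by (intro zero_less_power) (auto simp: annulus_def)
      then show ?thesis
        by (simp only: epow_rho_density[OF True] rho_star_powr powr_ge_zero cancel)
    qed simp
  qed
  also have "\<dots> = ennreal (sphere_area TYPE('a)) * (\<integral>\<^sup>+ r \<in> {r1<..<r2}. ?f r \<partial>lborel)"
    by (rule nn_integral_annulus_radial) (use r1_pos in auto)
  finally show ?thesis .
qed

text \<open>For an exponent \<open>q > 1\<close>,
  \<open>s powr q \<le> q * s powr (q - 1) * s\<close>, so the energy is at most the weighted
  integral of \<open>\<rho>s\<close>, which is \<open>lam\<close>. The equality case relies on this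
  finiteness.\<close>

lemma energy_rho_density_finite: "energy \<rho>s \<noteq> \<infinity>"
proof -
  have "energy \<rho>s \<le> (\<integral>\<^sup>+ x \<in> annulus r1 r2. w x * \<rho>s x \<partial>lborel)"
    unfolding energy_def
  proof (rule nn_integral_mono)
    fix x :: 'a
    show "epow (\<rho>s x) (p (norm x)) * indicator (annulus r1 r2) x \<le> w x * \<rho>s x * indicator (annulus r1 r2) x"
    proof (cases "x \<in> annulus r1 r2")
      case True
      define s where "s = rho_star p (sphere_area TYPE('a)) DIM('a) lam (norm x)"
      define q where "q = p (norm x)"
      have s: "0 < s" "1 < q" using rho_star_norm_pos[OF True] p_gt_1 by (auto simp: s_def q_def)
      have "s powr q = 1 * (s powr (q - 1) * s)" using s powr_add[of s "q - 1" 1] by simp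
      also have "\<dots> \<le> q * (s powr (q - 1) * s)" using s by (intro mult_right_mono) auto
      finally have "ennreal (s powr q) \<le> ennreal (q * s powr (q - 1)) * ennreal s"
        using s by (simp add: ennreal_mult[symmetric] mult.assoc)
      then show ?thesis
        using True by (simp add: epow_rho_density w_eq) (simp add: \<rho>s_def rho_density_def s_def q_def)
    qed simp
  qed
  then show ?thesis by (auto simp: weighted_integral_rho_density top_unique)
qed

lemma tangent_le:
  assumes "x \<in> annulus r1 r2"
  shows "epow (\<rho>s x) (p (norm x)) + w x * \<rho> \<le> epow \<rho> (p (norm x)) + w x * \<rho>s x"
  using epow_tangent_le[OF p_gt_1 rho_star_norm_pos[OF assms], where x=\<rho>] assms
  by (simp add: epow_rho_density w_eq) (simp add: \<rho>s_def rho_density_def)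

lemma tangent_eqD:
  assumes "x \<in> annulus r1 r2" "epow \<rho> (p (norm x)) \<noteq> top"
    and "epow (\<rho>s x) (p (norm x)) + w x * \<rho> = epow \<rho> (p (norm x)) + w x * \<rho>s x"
  shows "\<rho> = \<rho>s x"
proof -
  have "\<rho>s x = ennreal (rho_star p (sphere_area TYPE('a)) DIM('a) lam (norm x))"
    using assms(1) by (simp add: \<rho>s_def rho_density_def)
  with epow_tangent_eqD[OF p_gt_1 rho_star_norm_pos[OF assms(1)] assms(2)] assms(3)
  show ?thesis unfolding epow_rho_density[OF assms(1)] w_eq[OF assms(1)] by metis
qed

lemma nn_integral_annulus_add:
  fixes f g :: "'a \<Rightarrow> ennreal"
  assumes [measurable]: "f \<in> borel_measurable borel" "g \<in> borel_measurable borel"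
  shows "(\<integral>\<^sup>+ x. (f x + g x) * indicator (annulus r1 r2) x \<partial>lborel)
    = (\<integral>\<^sup>+ x \<in> annulus r1 r2. f x \<partial>lborel) + (\<integral>\<^sup>+ x \<in> annulus r1 r2. g x \<partial>lborel)"
  unfolding distrib_right by (rule nn_integral_add) auto

text \<open>The first two claims estimate the two sides of the integrated tangent inequality; the
  finite summand \<open>lam\<close> then cancels. They are kept as conclusions because the equality
  case needs them again.\<close>

lemma energy_le:
  assumes adm: "admissible (joining_curves r1 r2) \<rho>"
  shows "energy \<rho>s + ennreal lam \<le>
      (\<integral>\<^sup>+ x. (epow (\<rho>s x) (p (norm x)) + w x * \<rho> x) * indicator (annulus r1 r2) x \<partial>lborel)"
    and "(\<integral>\<^sup>+ x. (epow (\<rho> x) (p (norm x)) + w x * \<rho>s x) * indicator (annulus r1 r2) x \<partial>lborel)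
      = energy \<rho> + ennreal lam"
    and "energy \<rho>s \<le> energy \<rho>"
proof -
  have [measurable]: "\<rho> \<in> borel_measurable borel" "\<rho>s \<in> borel_measurable borel"
    using adm by (auto simp: admissible_def \<rho>s_def)
  show 1: "energy \<rho>s + ennreal lam \<le>
      (\<integral>\<^sup>+ x. (epow (\<rho>s x) (p (norm x)) + w x * \<rho> x) * indicator (annulus r1 r2) x \<partial>lborel)"
    using lam_le_weighted_integral[OF adm]
    by (subst nn_integral_annulus_add) (auto simp: energy_def intro: add_left_mono)
  show 2: "(\<integral>\<^sup>+ x. (epow (\<rho> x) (p (norm x)) + w x * \<rho>s x) * indicator (annulus r1 r2) x \<partial>lborel)
      = energy \<rho> + ennreal lam"
    by (subst nn_integral_annulus_add) (auto simp: energy_def weighted_integral_rho_density)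
  have "(\<integral>\<^sup>+ x. (epow (\<rho>s x) (p (norm x)) + w x * \<rho> x) * indicator (annulus r1 r2) x \<partial>lborel)
    \<le> (\<integral>\<^sup>+ x. (epow (\<rho> x) (p (norm x)) + w x * \<rho>s x) * indicator (annulus r1 r2) x \<partial>lborel)"
    by (intro nn_integral_mono) (auto intro: tangent_le split: split_indicator)
  from order_trans[OF 1 this[unfolded 2]]
  have "ennreal lam + energy \<rho>s \<le> ennreal lam + energy \<rho>" by (simp only: add.commute)
  then show "energy \<rho>s \<le> energy \<rho>" by (simp only: ennreal_add_left_cancel_le) simp
qed

text \<open>Equal energies close the chain of estimates, so the two sides of
  \<open>tangent_le\<close> have the same finite integral and agree almost everywhere. Finite energy
  also makes \<open>epow (\<rho> x) (p (norm x))\<close> finite almost everywhere in the annulus, as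
  \<open>tangent_eqD\<close> demands.\<close>

lemma AE_eq_rho_density:
  assumes adm: "admissible (joining_curves r1 r2) \<rho>" and E: "energy \<rho> = energy \<rho>s"
  shows "AE x in lborel. x \<in> annulus r1 r2 \<longrightarrow> \<rho> x = \<rho>s x"
proof -
  have [measurable]: "\<rho> \<in> borel_measurable borel" "\<rho>s \<in> borel_measurable borel"
    using adm by (auto simp: admissible_def \<rho>s_def)
  let ?f = "\<lambda>x. (epow (\<rho>s x) (p (norm x)) + w x * \<rho> x) * indicator (annulus r1 r2) x"
  let ?g = "\<lambda>x. (epow (\<rho> x) (p (norm x)) + w x * \<rho>s x) * indicator (annulus r1 r2) x"
  have le: "?f x \<le> ?g x" for x by (auto intro: tangent_le split: split_indicator)
  have ge: "integral\<^sup>N lborel ?g \<le> integral\<^sup>N lborel ?f" using energy_le(1,2)[OF adm] E by simp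
  have "integral\<^sup>N lborel ?f \<le> integral\<^sup>N lborel ?g" by (intro nn_integral_mono le)
  also have "\<dots> < \<infinity>" using energy_le(2)[OF adm] E energy_rho_density_finite by (simp add: top.not_eq_extremum)
  finally have "AE x in lborel. ?f x = ?g x" by (intro AE_eq_of_nn_integral_le le ge) auto
  moreover have "AE x in lborel. epow (\<rho> x) (p (norm x)) * indicator (annulus r1 r2) x \<noteq> \<infinity>"
    using E energy_rho_density_finite by (intro nn_integral_PInf_AE) (auto simp: energy_def)
  ultimately show ?thesis
  proof eventually_elim
    case (elim x)
    then show ?case using tangent_eqD[of x "\<rho> x"] by auto
  qed
qed

lemma pmodulus_eq_energy: "pmodulus r1 r2 (\<lambda>x. p (norm x)) (joining_curves r1 r2 :: (real \<Rightarrow> 'a) set) = energy \<rho>s"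
  unfolding pmodulus_def energy_def[symmetric]
proof (rule antisym)
  show "(INF \<rho> \<in> {\<rho> :: 'a \<Rightarrow> ennreal. admissible (joining_curves r1 r2) \<rho>}. energy \<rho>) \<le> energy \<rho>s"
    unfolding \<rho>s_def by (rule INF_lower) (simp add: admissible_rho_density norm1)
  show "energy \<rho>s \<le> (INF \<rho> \<in> {\<rho> :: 'a \<Rightarrow> ennreal. admissible (joining_curves r1 r2) \<rho>}. energy \<rho>)"
    by (rule INF_greatest) (simp add: energy_le(3))
qed

lemma extremal_density_iff:
  fixes \<rho> :: "'a \<Rightarrow> ennreal"
  shows "extremal_density r1 r2 (\<lambda>x. p (norm x)) (joining_curves r1 r2) \<rho>
    \<longleftrightarrow> admissible (joining_curves r1 r2) \<rho> \<and> energy \<rho> = energy \<rho>s"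
  unfolding extremal_density_def pmodulus_eq_energy energy_def[symmetric] ..

lemma extremal_rho_density:
  "extremal_density r1 r2 (\<lambda>x. p (norm x)) (joining_curves r1 r2) \<rho>s"
  "extremal_density r1 r2 (\<lambda>x. p (norm x)) (joining_curves r1 r2) \<rho> \<Longrightarrow>
    AE x in lborel. x \<in> annulus r1 r2 \<longrightarrow> \<rho> x = \<rho>s x"
  using AE_eq_rho_density admissible_rho_density[OF norm1] by (auto simp: extremal_density_iff \<rho>s_def)

end

end

section \<open>Transfer to an exponent prescribed only between the radii\<close>

lemma pmodulus_cong:
  fixes q q' :: "'a::euclidean_space \<Rightarrow> real"
  assumes "\<And>x. x \<in> annulus r1 r2 \<Longrightarrow> q x = q' x"
  shows "pmodulus r1 r2 q \<Gamma> = pmodulus r1 r2 q' \<Gamma>"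
    and "extremal_density r1 r2 q \<Gamma> \<rho> \<longleftrightarrow> extremal_density r1 r2 q' \<Gamma> \<rho>"
proof -
  have "(\<integral>\<^sup>+ x \<in> annulus r1 r2. epow (\<rho> x) (q x) \<partial>lborel) = (\<integral>\<^sup>+ x \<in> annulus r1 r2. epow (\<rho> x) (q' x) \<partial>lborel)" for \<rho>
    using assms by (intro nn_integral_cong) (auto split: split_indicator)
  then show "pmodulus r1 r2 q \<Gamma> = pmodulus r1 r2 q' \<Gamma>"
    "extremal_density r1 r2 q \<Gamma> \<rho> \<longleftrightarrow> extremal_density r1 r2 q' \<Gamma> \<rho>"
    by (simp_all only: pmodulus_def extremal_density_def)
qed

theorem theorem4p4:
  fixes r1 r2 :: real and p :: "real \<Rightarrow> real" and n :: nat
  defines "n \<equiv> DIM('a::euclidean_space)"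
  defines "\<omega> \<equiv> sphere_area TYPE('a)"
  defines "\<Gamma> \<equiv> (joining_curves r1 r2 :: (real \<Rightarrow> 'a) set)"
  assumes r: "0 < r1" "r1 < r2"
    and p_meas: "set_borel_measurable borel {r1<..<r2} p"
    and p_bounds: "\<exists>pm pM. 1 < pm \<and> (\<forall>r\<in>{r1<..<r2}. pm \<le> p r \<and> p r \<le> pM)"
  shows "(\<exists>!lam. 0 < lam \<and> (\<integral>\<^sup>+ r \<in> {r1<..<r2}. ennreal (rho_star p \<omega> n lam r) \<partial>lborel) = 1)
    \<and> (\<forall>lam. 0 < lam \<and> (\<integral>\<^sup>+ r \<in> {r1<..<r2}. ennreal (rho_star p \<omega> n lam r) \<partial>lborel) = 1 \<longrightarrow>
        (let \<rho>s = (\<lambda>x::'a. if x \<in> annulus r1 r2 then ennreal (rho_star p \<omega> n lam (norm x)) else 0) in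
          extremal_density r1 r2 (\<lambda>x. p (norm x)) \<Gamma> \<rho>s
          \<and> (\<forall>\<rho>. extremal_density r1 r2 (\<lambda>x. p (norm x)) \<Gamma> \<rho> \<longrightarrow>
                 (AE x in lborel. x \<in> annulus r1 r2 \<longrightarrow> \<rho> x = \<rho>s x))
          \<and> pmodulus r1 r2 (\<lambda>x. p (norm x)) \<Gamma> =
              ennreal \<omega> * (\<integral>\<^sup>+ r \<in> {r1<..<r2}.
                 ennreal ((lam / (p r * \<omega> * r ^ (n - 1))) powr (p r / (p r - 1)) * r ^ (n - 1)) \<partial>lborel)))"
proof -
  obtain pm pM where pm: "1 < pm" and pb: "\<And>r. r \<in> {r1<..<r2} \<Longrightarrow> pm \<le> p r \<and> p r \<le> pM"
    using p_bounds by blast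
  have pmM: "pm \<le> pM" using pb[of "(r1 + r2) / 2"] r by auto
  \<comment> \<open>Outside \<open>{r1<..<r2}\<close> the exponent \<open>p\<close> may be neither bounded nor measurable.\<close>
  define P where "P r = (if r \<in> {r1<..<r2} then p r else pm)" for r
  have P: "P r = p r" if "r \<in> {r1<..<r2}" for r using that by (simp add: P_def)
  have "P \<in> borel_measurable borel"
  proof -
    \<comment> \<open>\<open>p_meas\<close> concerns the product of \<open>p\<close> with the
      indicator, so the first branch is written with that product.\<close>
    have "(\<lambda>r. if r \<in> {r1<..<r2} then indicator {r1<..<r2} r *\<^sub>R p r else pm) \<in> borel_measurable borel"
      using p_meas unfolding set_borel_measurable_def by measurable
    also have "(\<lambda>r. if r \<in> {r1<..<r2} then indicator {r1<..<r2} r *\<^sub>R p r else pm) = P"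
      by (auto simp: P_def fun_eq_iff)
    finally show ?thesis .
  qed
  then interpret radial_exponent P r1 r2 pm pM
    using r pm pb pmM by unfold_locales (auto simp: P_def)
  have rs: "rho_star p \<omega> n lam r = rho_star P \<omega> n lam r" if "r \<in> {r1<..<r2}" for lam r
    using P[OF that] by (simp add: rho_star_def)
  have int: "(\<integral>\<^sup>+ r \<in> {r1<..<r2}. ennreal (rho_star p \<omega> n lam r) \<partial>lborel) = rho_integral \<omega> n lam" for lam
    unfolding rho_integral_def using rs by (intro nn_integral_cong) (auto split: split_indicator)
  have eq: "p (norm x) = P (norm x)" if "x \<in> annulus r1 r2" for x :: 'a
    using that P[of "norm x"] by (simp add: annulus_def)
  have dens: "(if x \<in> annulus r1 r2 then ennreal (rho_star p \<omega> n lam (norm x)) else 0) = rho_density lam x" for lam and x :: 'a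
    using rs by (auto simp: rho_density_def annulus_def n_def \<omega>_def)
  have formula: "(\<integral>\<^sup>+ r \<in> {r1<..<r2}. ennreal ((lam / (p r * \<omega> * r ^ (n - 1))) powr (p r / (p r - 1)) * r ^ (n - 1)) \<partial>lborel)
    = (\<integral>\<^sup>+ r \<in> {r1<..<r2}. ennreal ((lam / (P r * \<omega> * r ^ (n - 1))) powr (P r / (P r - 1)) * r ^ (n - 1)) \<partial>lborel)" for lam
    using P by (intro nn_integral_cong) (auto split: split_indicator)
  have key: "extremal_density r1 r2 (\<lambda>x. P (norm x)) (joining_curves r1 r2) (rho_density lam :: 'a \<Rightarrow> ennreal)
      \<and> (\<forall>\<rho> :: 'a \<Rightarrow> ennreal. extremal_density r1 r2 (\<lambda>x. P (norm x)) (joining_curves r1 r2) \<rho> \<longrightarrow>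
             (AE x in lborel. x \<in> annulus r1 r2 \<longrightarrow> \<rho> x = rho_density lam x))
      \<and> pmodulus r1 r2 (\<lambda>x. P (norm x)) (joining_curves r1 r2 :: (real \<Rightarrow> 'a) set) = ennreal \<omega> *
        (\<integral>\<^sup>+ r \<in> {r1<..<r2}. ennreal ((lam / (P r * \<omega> * r ^ (n - 1))) powr (P r / (P r - 1)) * r ^ (n - 1)) \<partial>lborel)"
    if "0 < lam \<and> rho_integral \<omega> n lam = 1" for lam
  proof -
    from that have lam: "0 < lam" "rho_integral (sphere_area TYPE('a)) DIM('a) lam = 1"
      by (simp_all add: \<omega>_def n_def)
    show ?thesis
      unfolding pmodulus_eq_energy[OF lam] energy_rho_density[OF lam] \<omega>_def n_def
      by (intro conjI allI impI refl extremal_rho_density[OF lam])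
  qed
  have ex1: "\<exists>!lam. 0 < lam \<and> rho_integral \<omega> n lam = 1"
    unfolding \<omega>_def by (rule ex1_rho_integral_eq_1[OF sphere_area_pos])
  have cong: "pmodulus r1 r2 (\<lambda>x. p (norm x)) G = pmodulus r1 r2 (\<lambda>x. P (norm x)) G"
    "extremal_density r1 r2 (\<lambda>x. p (norm x)) G \<rho> \<longleftrightarrow> extremal_density r1 r2 (\<lambda>x. P (norm x)) G \<rho>"
    for G :: "(real \<Rightarrow> 'a) set" and \<rho>
    by (rule pmodulus_cong; simp add: eq)+
  show ?thesis
    unfolding int Let_def dens formula cong \<Gamma>_def
    by (rule conjI[OF ex1], rule allI, rule impI, rule key)
qed

end
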